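(* Let $\mathcal{T}$ be a simplicial tree and $G \leq \mathrm{Aut}(\mathcal{T})$. Suppose that the action of $G$ on $\mathcal{T}$ is minimal and of general type, and that the action of $G$ on $\partial \mathcal{T}$ is not topologically free. Assume that $G$ acts faithfully and $3$-transitively on a set $\Omega$. Then there exists a $G$-orbit $\mathcal{O} \subset \partial \mathcal{T}$ such that the actions of $G$ on $\Omega$ and on $\mathcal{O}$ are conjugate.
   Context: An automorphism of $\mathcal{T}$ is elliptic if it stabilizes a vertex or an edge, and hyperbolic if it acts as a non-trivial translation along a bi-infinite geodesic (its axis), whose two ends are its endpoints. The action of $G$ on $\mathcal{T}$ is minimal if there is no proper $G$-invariant subtree; it is of general type if $G$ contains two hyperbolic elements having no common endpoint. $\partial\mathcal{T}$ is the space of ends of $\mathcal{T}$ with its usual topology; the action on $\partial\mathcal{T}$ is topologically free if the fixed point set in $\partial\mathcal{T}$ of every non-trivial element of $G$ has empty interior. An action on $\Omega$ is $3$-transitive if $G$ acts transitively on ordered triples of distinct elements of $\Omega$. Two actions are conjugate if there is a $G$-equivariant bijection between the sets. *)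

theory Defs
  imports "HOL-Analysis.Analysis"
begin

definition walk :: "('v \<Rightarrow> 'v \<Rightarrow> bool) \<Rightarrow> 'v list \<Rightarrow> bool" where
  "walk adj xs \<longleftrightarrow> (\<forall>i. i + 1 < length xs \<longrightarrow> adj (xs ! i) (xs ! (i + 1)))"

definition reduced :: "'v list \<Rightarrow> bool" where
  "reduced xs \<longleftrightarrow> (\<forall>i. i + 2 < length xs \<longrightarrow> xs ! i \<noteq> xs ! (i + 2))"

definition is_tree :: "('v \<Rightarrow> 'v \<Rightarrow> bool) \<Rightarrow> bool" where
  "is_tree adj \<longleftrightarrow> (\<forall>x y. adj x y \<longrightarrow> adj y x) \<and> (\<forall>x. \<not> adj x x)
     \<and> (\<forall>x y. adj\<^sup>*\<^sup>* x y)
     \<and> (\<forall>xs. walk adj xs \<and> reduced xs \<longrightarrow> distinct xs)"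

definition is_aut :: "('v \<Rightarrow> 'v \<Rightarrow> bool) \<Rightarrow> ('v \<Rightarrow> 'v) \<Rightarrow> bool" where
  "is_aut adj g \<longleftrightarrow> bij g \<and> (\<forall>x y. adj (g x) (g y) \<longleftrightarrow> adj x y)"

definition aut_subgroup :: "('v \<Rightarrow> 'v \<Rightarrow> bool) \<Rightarrow> ('v \<Rightarrow> 'v) set \<Rightarrow> bool" where
  "aut_subgroup adj G \<longleftrightarrow> (\<forall>g\<in>G. is_aut adj g) \<and> id \<in> G
     \<and> (\<forall>g\<in>G. \<forall>h\<in>G. g \<circ> h \<in> G) \<and> (\<forall>g\<in>G. inv g \<in> G)"

definition ray :: "('v \<Rightarrow> 'v \<Rightarrow> bool) \<Rightarrow> (nat \<Rightarrow> 'v) \<Rightarrow> bool" where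
  "ray adj r \<longleftrightarrow> (\<forall>n. adj (r n) (r (Suc n)) \<and> r n \<noteq> r (Suc (Suc n)))"

definition line :: "('v \<Rightarrow> 'v \<Rightarrow> bool) \<Rightarrow> (int \<Rightarrow> 'v) \<Rightarrow> bool" where
  "line adj l \<longleftrightarrow> (\<forall>i. adj (l i) (l (i + 1)) \<and> l i \<noteq> l (i + 2))"

definition end_of :: "('v \<Rightarrow> 'v \<Rightarrow> bool) \<Rightarrow> (nat \<Rightarrow> 'v) \<Rightarrow> (nat \<Rightarrow> 'v) set" where
  "end_of adj r = {s. ray adj s \<and> (\<exists>k m. \<forall>n. s (n + k) = r (n + m))}"

definition ends :: "('v \<Rightarrow> 'v \<Rightarrow> bool) \<Rightarrow> (nat \<Rightarrow> 'v) set set" where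
  "ends adj = {end_of adj r | r. ray adj r}"

definition end_act :: "('v \<Rightarrow> 'v) \<Rightarrow> (nat \<Rightarrow> 'v) set \<Rightarrow> (nat \<Rightarrow> 'v) set" where
  "end_act g \<xi> = (\<lambda>r. g \<circ> r) ` \<xi>"

text \<open>Shadow of an oriented edge (u,w): ends represented by a ray starting with u, w.
  These sets generate the usual topology on the space of ends.\<close>
definition shadow :: "('v \<Rightarrow> 'v \<Rightarrow> bool) \<Rightarrow> 'v \<Rightarrow> 'v \<Rightarrow> (nat \<Rightarrow> 'v) set set" where
  "shadow adj u w = {\<xi> \<in> ends adj. \<exists>r\<in>\<xi>. r 0 = u \<and> r 1 = w}"

definition boundary_topology :: "('v \<Rightarrow> 'v \<Rightarrow> bool) \<Rightarrow> (nat \<Rightarrow> 'v) set topology" where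
  "boundary_topology adj = topology (generate_topology_on ((\<lambda>(u, w). shadow adj u w) ` {(u, w). adj u w}))"

definition end_fix :: "('v \<Rightarrow> 'v \<Rightarrow> bool) \<Rightarrow> ('v \<Rightarrow> 'v) \<Rightarrow> (nat \<Rightarrow> 'v) set set" where
  "end_fix adj g = {\<xi> \<in> ends adj. end_act g \<xi> = \<xi>}"

definition topologically_free :: "('v \<Rightarrow> 'v \<Rightarrow> bool) \<Rightarrow> ('v \<Rightarrow> 'v) set \<Rightarrow> bool" where
  "topologically_free adj G \<longleftrightarrow>
     (\<forall>g\<in>G. g \<noteq> id \<longrightarrow> boundary_topology adj interior_of end_fix adj g = {})"

definition translates :: "('v \<Rightarrow> 'v \<Rightarrow> bool) \<Rightarrow> ('v \<Rightarrow> 'v) \<Rightarrow> (int \<Rightarrow> 'v) \<Rightarrow> int \<Rightarrow> bool" where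
  "translates adj g l k \<longleftrightarrow> line adj l \<and> k > 0 \<and> (\<forall>i. g (l i) = l (i + k))"

definition hyperbolic :: "('v \<Rightarrow> 'v \<Rightarrow> bool) \<Rightarrow> ('v \<Rightarrow> 'v) \<Rightarrow> bool" where
  "hyperbolic adj g \<longleftrightarrow> (\<exists>l k. translates adj g l k)"

definition endpoints :: "('v \<Rightarrow> 'v \<Rightarrow> bool) \<Rightarrow> ('v \<Rightarrow> 'v) \<Rightarrow> (nat \<Rightarrow> 'v) set set" where
  "endpoints adj g = {\<xi>. \<exists>l k. translates adj g l k \<and>
      (\<xi> = end_of adj (\<lambda>n. l (int n)) \<or> \<xi> = end_of adj (\<lambda>n. l (- int n)))}"

definition general_type :: "('v \<Rightarrow> 'v \<Rightarrow> bool) \<Rightarrow> ('v \<Rightarrow> 'v) set \<Rightarrow> bool" where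
  "general_type adj G \<longleftrightarrow> (\<exists>g\<in>G. \<exists>h\<in>G. hyperbolic adj g \<and> hyperbolic adj h
      \<and> endpoints adj g \<inter> endpoints adj h = {})"

definition subtree :: "('v \<Rightarrow> 'v \<Rightarrow> bool) \<Rightarrow> 'v set \<Rightarrow> bool" where
  "subtree adj S \<longleftrightarrow> S \<noteq> {} \<and> (\<forall>x\<in>S. \<forall>y\<in>S. (\<lambda>a b. adj a b \<and> a \<in> S \<and> b \<in> S)\<^sup>*\<^sup>* x y)"

definition minimal_action :: "('v \<Rightarrow> 'v \<Rightarrow> bool) \<Rightarrow> ('v \<Rightarrow> 'v) set \<Rightarrow> bool" where
  "minimal_action adj G \<longleftrightarrow> (\<forall>S. subtree adj S \<and> (\<forall>g\<in>G. g ` S \<subseteq> S) \<longrightarrow> S = UNIV)"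

definition is_action :: "('g \<Rightarrow> 'g \<Rightarrow> 'g) \<Rightarrow> 'g \<Rightarrow> 'g set \<Rightarrow> 'w set \<Rightarrow> ('g \<Rightarrow> 'w \<Rightarrow> 'w) \<Rightarrow> bool" where
  "is_action gmul e G \<Omega> act \<longleftrightarrow> (\<forall>g\<in>G. \<forall>x\<in>\<Omega>. act g x \<in> \<Omega>)
     \<and> (\<forall>x\<in>\<Omega>. act e x = x)
     \<and> (\<forall>g\<in>G. \<forall>h\<in>G. \<forall>x\<in>\<Omega>. act (gmul g h) x = act g (act h x))"

definition faithful_action :: "'g \<Rightarrow> 'g set \<Rightarrow> 'w set \<Rightarrow> ('g \<Rightarrow> 'w \<Rightarrow> 'w) \<Rightarrow> bool" where
  "faithful_action e G \<Omega> act \<longleftrightarrow> (\<forall>g\<in>G. (\<forall>x\<in>\<Omega>. act g x = x) \<longrightarrow> g = e)"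

definition three_transitive :: "'g set \<Rightarrow> 'w set \<Rightarrow> ('g \<Rightarrow> 'w \<Rightarrow> 'w) \<Rightarrow> bool" where
  "three_transitive G \<Omega> act \<longleftrightarrow> (\<forall>a\<in>\<Omega>. \<forall>b\<in>\<Omega>. \<forall>c\<in>\<Omega>. \<forall>a'\<in>\<Omega>. \<forall>b'\<in>\<Omega>. \<forall>c'\<in>\<Omega>.
     distinct [a, b, c] \<and> distinct [a', b', c'] \<longrightarrow>
     (\<exists>g\<in>G. act g a = a' \<and> act g b = b' \<and> act g c = c'))"

definition conjugate_actions :: "'g set \<Rightarrow> 'w set \<Rightarrow> ('g \<Rightarrow> 'w \<Rightarrow> 'w) \<Rightarrow> 'u set \<Rightarrow> ('g \<Rightarrow> 'u \<Rightarrow> 'u) \<Rightarrow> bool" where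
  "conjugate_actions G \<Omega> act Orb act' \<longleftrightarrow> (\<exists>\<phi>. bij_betw \<phi> \<Omega> Orb \<and>
     (\<forall>g\<in>G. \<forall>x\<in>\<Omega>. \<phi> (act g x) = act' g (\<phi> x)))"

definition end_orbit :: "('v \<Rightarrow> 'v) set \<Rightarrow> (nat \<Rightarrow> 'v) set \<Rightarrow> (nat \<Rightarrow> 'v) set set" where
  "end_orbit G \<xi> = (\<lambda>g. end_act g \<xi>) ` G"

end

theory Submission
  imports Defs
begin

text \<open>For a half-tree \<open>A\<close> let \<open>rigid A\<close> be the group of elements supported in \<open>A\<close>. General type and
  non-freeness make these groups non-trivial, and \<open>rigid A\<close>, \<open>rigid B\<close> commute for disjoint \<open>A\<close>, \<open>B\<close>.
  Assigning to each point \<open>x\<close> of \<open>\<Omega>\<close>, equivariantly, an upward closed and pairwise intersecting family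
  of half-trees suffices: such a family shrinks to an end fixed by the stabilizer of \<open>x\<close>, because a
  common vertex is excluded by 2-transitivity and unboundedness.

  Given two pairs of disjoint half-trees, some member of the first is disjoint from some member of the
  second. With 3-transitivity this gives a dichotomy for elements with disjoint supports in the tree: if
  they have a common fixed point in \<open>\<Omega>\<close>, then no point of \<open>\<Omega>\<close> is moved by both. By the same kind of
  argument some non-trivial elements of the groups \<open>rigid A\<close> do fix a point of \<open>\<Omega>\<close>. Among these, either
  pairs with disjoint supports in the tree never move a common point, or they never fix one. The family
  at \<open>x\<close> consists of the half-trees supporting such an element which moves \<open>x\<close>, respectively fixes \<open>x\<close>.\<close>

section \<open>Paths and distance in a tree\<close>

text \<open>Nothing ties \<Omega> to the tree in advance; the only bridge is commutation: if
  \<open>b\<close> commutes with \<open>a\<close> and fixes a point, it also fixes the image of that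
  point under \<open>a\<close>. The obstacle is that an element \<open>g\<close> obtained from
  3-transitivity is known only on three points of \<Omega>, so it may carry a half-tree anywhere.
  Hence supports are handled in pairs: wherever \<open>g\<close> has put a disjoint pair, one of its
  members is separated from one member of a prescribed pair, and the arguments are arranged so that
  each of the possible choices gives the conclusion. Three points are what this costs: a base point
  and one image for each member of the pair. Passing from one pair of supports to another needs in
  addition a third half-tree disjoint from both, which is why the families that define the ends keep
  a spare half-tree in reserve.\<close>

lemma walk_simps [simp]:
  "walk adj []" "walk adj [x]" "walk adj (x # y # zs) \<longleftrightarrow> adj x y \<and> walk adj (y # zs)"
  unfolding walk_def by (auto simp: nth_Cons split: nat.splits)

lemma reduced_simps [simp]:
  "reduced []" "reduced [x]" "reduced [x, y]"
  "reduced (x # y # z # zs) \<longleftrightarrow> x \<noteq> z \<and> reduced (y # z # zs)"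
  unfolding reduced_def by (auto simp: nth_Cons numeral_2_eq_2 split: nat.splits)

lemma walk_append:
  "walk adj (xs @ y # zs) \<longleftrightarrow> walk adj (xs @ [y]) \<and> walk adj (y # zs)"
proof (induction xs)
  case (Cons x xs)
  then show ?case by (cases xs) auto
qed simp

text \<open>Reducedness compares entries two apart, so the two pieces have to share two entries,
  where \<open>walk_append\<close> needs only one.\<close>

lemma reduced_append:
  "reduced (xs @ y # z # zs) \<longleftrightarrow> reduced (xs @ [y, z]) \<and> reduced (y # z # zs)"
proof (induction xs rule: induct_list012)
  case (3 x x' xs)
  then show ?case by (cases xs) auto
qed auto

lemma walk_rev: "(\<And>x y. adj x y \<Longrightarrow> adj y x) \<Longrightarrow> walk adj xs \<Longrightarrow> walk adj (rev xs)"
proof (induction xs rule: induct_list012)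
  case (3 x y zs)
  then show ?case using walk_append[of adj "rev zs" y "[x]"] by auto
qed auto

lemma reduced_rev: "reduced xs \<Longrightarrow> reduced (rev xs)"
proof (induction xs)
  case (Cons x xs)
  show ?case
  proof (cases xs)
    case Nil then show ?thesis by simp
  next
    case (Cons y ys)
    note xs = Cons
    show ?thesis
    proof (cases ys)
      case Nil then show ?thesis using xs by simp
    next
      case (Cons z zs)
      then show ?thesis using Cons.IH Cons.prems xs reduced_append[of "rev zs" z y "[x]"] by auto
    qed
  qed
qed simp

locale tree =
  fixes adj :: "'v \<Rightarrow> 'v \<Rightarrow> bool"
  assumes tree: "is_tree adj"
begin

lemma adj_sym: "adj x y \<Longrightarrow> adj y x"
  and adj_irrefl [simp]: "\<not> adj x x"
  and connected: "adj\<^sup>*\<^sup>* x y"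
  and reduced_walk_distinct: "walk adj xs \<Longrightarrow> reduced xs \<Longrightarrow> distinct xs"
  using tree unfolding is_tree_def by auto

definition rpath :: "'v \<Rightarrow> 'v \<Rightarrow> 'v list \<Rightarrow> bool" where
  "rpath x y xs \<longleftrightarrow> walk adj xs \<and> reduced xs \<and> xs \<noteq> [] \<and> hd xs = x \<and> last xs = y"

text \<open>Where two reduced paths from \<open>x\<close> part, the reverse of one followed by the
  other is a reduced walk through \<open>x\<close>. It would visit \<open>y\<close> twice, which the
  definition of a tree forbids.\<close>

lemma rpath_unique: "rpath x y xs \<Longrightarrow> rpath x y ys \<Longrightarrow> xs = ys"
proof (induction xs arbitrary: x ys)
  case Nil
  then show ?case by (simp add: rpath_def)
next
  case (Cons c xs')
  have c: "c = x" using Cons.prems by (simp add: rpath_def)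
  obtain ys' where ys: "ys = x # ys'" using Cons.prems(2) by (cases ys) (auto simp: rpath_def)
  have dx: "distinct (x # xs')" and dy: "distinct (x # ys')"
    using Cons.prems reduced_walk_distinct ys c unfolding rpath_def by metis+
  show ?case
  proof (cases "xs' = [] \<or> ys' = []")
    case True
    then show ?thesis using Cons.prems dx dy ys c
      by (auto simp: rpath_def split: if_splits)
  next
    case False
    then obtain a xs2 b ys2 where xs': "xs' = a # xs2" and ys': "ys' = b # ys2"
      by (meson list.exhaust)
    show ?thesis
    proof (cases "a = b")
      case True
      have "reduced xs'" "reduced ys'"
        using Cons.prems xs' ys ys' by (cases xs2; cases ys2; auto simp: rpath_def)+
      then have "rpath a y xs'" "rpath a y ys'"
        using Cons.prems xs' ys' ys True by (auto simp: rpath_def)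
      then show ?thesis using Cons.IH ys c by blast
    next
      case False
      have 1: "walk adj (rev xs2 @ [a, x])" "reduced (rev xs2 @ [a, x])"
        using walk_rev[of adj "x # a # xs2"] reduced_rev[of "x # a # xs2"] adj_sym Cons.prems(1)
        by (auto simp: rpath_def xs' c)
      have 2: "walk adj (x # b # ys2)" "reduced (x # b # ys2)"
        using Cons.prems(2) by (auto simp: rpath_def ys ys')
      have w: "walk adj (rev xs2 @ a # x # b # ys2)"
        using 1 2 walk_append[of adj "rev xs2" a "x # b # ys2"] walk_append[of adj "rev xs2" a "[x]"]
        by auto
      have "reduced (a # x # b # ys2)" using 2 False by auto
      then have "reduced (rev xs2 @ a # x # b # ys2)"
        using 1 reduced_append[of "rev xs2" a x "b # ys2"] by auto
      with w have "distinct (rev xs2 @ a # x # b # ys2)" by (rule reduced_walk_distinct)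
      moreover have "y \<in> set xs'" "y \<in> set ys'"
        using Cons.prems last_in_set[of xs'] last_in_set[of ys']
        unfolding rpath_def by (simp_all add: ys xs' ys')
      ultimately show ?thesis unfolding xs' ys' by auto
    qed
  qed
qed

text \<open>A further edge either retraces the last one or keeps the path reduced. Existence of
  paths and the behaviour of distance along an edge both rest on this alternative.\<close>

lemma rpath_snoc:
  assumes "rpath x y xs" "adj y z"
  shows "(\<exists>ps. xs = ps @ [z, y] \<and> rpath x z (ps @ [z])) \<or> rpath x z (xs @ [z])"
proof -
  obtain qs where xs: "xs = qs @ [y]"
    using assms(1) by (metis rpath_def append_butlast_last_id)
  show ?thesis
  proof (cases qs rule: rev_cases)
    case Nil
    then show ?thesis using assms xs by (auto simp: rpath_def)
  next
    case (snoc ps a)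
    note q = snoc
    have w: "walk adj (ps @ [a])" "adj a y"
      using assms(1) walk_append[of adj ps a "[y]"] by (auto simp: rpath_def xs q)
    show ?thesis
    proof (cases "a = z")
      case True
      have "reduced (ps @ [z])"
      proof (cases ps rule: rev_cases)
        case (snoc ps' b)
        then show ?thesis using assms(1) reduced_append[of ps' b z "[y]"]
          by (auto simp: rpath_def xs q True)
      qed simp
      moreover have "hd (ps @ [z]) = x" using assms(1) by (cases ps) (auto simp: rpath_def xs q True)
      ultimately show ?thesis using w True xs q by (auto simp: rpath_def)
    next
      case False
      have "walk adj (ps @ [a, y, z])"
        using assms walk_append[of adj ps a "[y, z]"] w by auto
      moreover have "reduced (ps @ [a, y, z])"
        using assms False reduced_append[of ps a y "[z]"] by (auto simp: rpath_def xs q)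
      moreover have "hd (ps @ [a, y, z]) = x" using assms(1) by (cases ps) (auto simp: rpath_def xs q)
      ultimately show ?thesis using xs q by (auto simp: rpath_def)
    qed
  qed
qed

lemma rpath_exists: "\<exists>xs. rpath x y xs"
  using connected[of x y]
proof (induction rule: rtranclp_induct)
  case base
  show ?case by (rule exI[of _ "[x]"]) (simp add: rpath_def)
next
  case (step y z)
  then show ?case using rpath_snoc by blast
qed

definition d :: "'v \<Rightarrow> 'v \<Rightarrow> nat" where
  "d x y = length (THE xs. rpath x y xs) - 1"

lemma d_eq: "rpath x y xs \<Longrightarrow> Suc (d x y) = length xs"
proof -
  assume a: "rpath x y xs"
  then have "(THE xs. rpath x y xs) = xs" using rpath_unique by blast
  with a show ?thesis unfolding d_def by (cases xs) (auto simp: rpath_def[of _ _ "[]"])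
qed

lemma d_sym: "d x y = d y x"
proof -
  obtain xs where xs: "rpath x y xs" using rpath_exists by blast
  then have "rpath y x (rev xs)"
    using walk_rev reduced_rev adj_sym by (auto simp: rpath_def hd_rev last_rev)
  from d_eq[OF this] d_eq[OF xs] show ?thesis by simp
qed

lemma d_self [simp]: "d x x = 0"
  using d_eq[of x x "[x]"] by (simp add: rpath_def)

lemma d_step: "adj y z \<Longrightarrow> d x z = Suc (d x y) \<or> d x y = Suc (d x z)"
proof -
  assume a: "adj y z"
  obtain xs where xs: "rpath x y xs" using rpath_exists by blast
  from rpath_snoc[OF xs a] d_eq[OF xs] show ?thesis
    by (auto dest!: d_eq)
qed

lemma d_zero [simp]: "d x y = 0 \<longleftrightarrow> x = y"
proof
  assume a: "d x y = 0"
  obtain xs where xs: "rpath x y xs" using rpath_exists by blast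
  then have "length xs = 1" using d_eq a by force
  then show "x = y" using xs by (auto simp: rpath_def length_Suc_conv)
qed simp

lemma d_adj: "adj x y \<Longrightarrow> d x y = 1"
  using d_step[of x y x] by simp

text \<open>A neighbour of \<open>y\<close> nearer to \<open>x\<close> has to be the penultimate
  vertex of the reduced path from \<open>x\<close> to \<open>y\<close>.\<close>

lemma closer_unique:
  assumes "adj y z" "d x y = Suc (d x z)" "adj y z'" "d x y = Suc (d x z')"
  shows "z = z'"
proof -
  obtain xs where xs: "rpath x y xs" using rpath_exists by blast
  have "\<exists>ps. xs = ps @ [z, y]" using rpath_snoc[OF xs assms(1)] d_eq[OF xs] assms(2)
    by (auto dest!: d_eq)
  moreover have "\<exists>ps. xs = ps @ [z', y]" using rpath_snoc[OF xs assms(3)] d_eq[OF xs] assms(4)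
    by (auto dest!: d_eq)
  ultimately show ?thesis by auto
qed

lemma closer_exists:
  assumes "x \<noteq> y" obtains z where "adj y z" "d x y = Suc (d x z)"
proof -
  obtain xs where xs: "rpath x y xs" using rpath_exists by blast
  then obtain qs where q: "xs = qs @ [y]" by (metis rpath_def append_butlast_last_id)
  with xs assms obtain ps z where p: "xs = ps @ [z, y]"
    by (cases qs rule: rev_cases) (auto simp: rpath_def)
  then have a: "adj y z" using xs adj_sym walk_append[of adj ps z "[y]"] by (auto simp: rpath_def)
  have "\<not> rpath x z (xs @ [z])"
    using reduced_walk_distinct[of "xs @ [z]"] p unfolding rpath_def by auto
  with rpath_snoc[OF xs a] p have "rpath x z (ps @ [z])" by auto
  with a that show ?thesis using d_eq[OF xs] p by (auto dest!: d_eq)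
qed

section \<open>Half-trees\<close>

text \<open>For an edge this is the component of \<open>w\<close> after deletion of the edge. Stated
  through distances, complements follow from \<open>d_step\<close> and images under automorphisms
  from \<open>d_aut\<close>.\<close>

definition H :: "'v \<Rightarrow> 'v \<Rightarrow> 'v set" where
  "H u w = {v. d v w < d v u}"

definition halftrees :: "'v set set" where
  "halftrees = {H u w | u w. adj u w}"

lemma halftreeI: "adj u w \<Longrightarrow> H u w \<in> halftrees"
  unfolding halftrees_def by blast

lemma halftreeE: "A \<in> halftrees \<Longrightarrow> (\<And>u w. adj u w \<Longrightarrow> A = H u w \<Longrightarrow> P) \<Longrightarrow> P"
  unfolding halftrees_def by blast

lemma H_compl: "adj u w \<Longrightarrow> - H u w = H w u"
  unfolding H_def using d_step[of u w] by (auto simp: not_less) (metis Suc_n_not_le_n le_neq_implies_less)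

lemma halftree_compl: "A \<in> halftrees \<Longrightarrow> - A \<in> halftrees"
  by (metis halftreeE halftreeI H_compl adj_sym)

lemma in_H: "adj u w \<Longrightarrow> w \<in> H u w" and notin_H [simp]: "u \<notin> H u w"
  unfolding H_def by (auto dest: d_adj simp: d_sym[of w u])

lemma mem_H: "adj u w \<Longrightarrow> v \<in> H u w \<longleftrightarrow> d v u = Suc (d v w)"
  unfolding H_def using d_step[of u w v] by auto

text \<open>If \<open>a\<close> were not \<open>u\<close>, then \<open>b\<close> and the neighbour
  of \<open>a\<close> towards \<open>u\<close> would both be neighbours of \<open>a\<close> nearer
  to \<open>w\<close>, hence equal, although \<open>b\<close> is farther from \<open>u\<close> than
  \<open>a\<close> is.\<close>

lemma H_crossing:
  assumes "adj u w" "adj a b" "a \<notin> H u w" "b \<in> H u w"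
  shows "a = u \<and> b = w"
proof -
  have 1: "d a w = Suc (d a u)" using assms mem_H[of u w a] d_step[of u w a] by auto
  have 2: "d b u = Suc (d b w)" using assms mem_H by auto
  have 3: "d u b = Suc (d u a) \<or> d u a = Suc (d u b)" "d w b = Suc (d w a) \<or> d w a = Suc (d w b)"
    using d_step[OF assms(2)] by blast+
  then have 4: "d u a = d w b" using 1 2 d_sym[of a w] d_sym[of a u] d_sym[of b w] d_sym[of b u] by linarith
  have "d u a = 0"
  proof (rule ccontr)
    assume "d u a \<noteq> 0"
    then have "u \<noteq> a" by simp
    then obtain a' where a': "adj a a'" "d u a = Suc (d u a')" using closer_exists by blast
    have "d a' w \<le> Suc (d a' u)" using d_step[OF assms(1), of a'] by auto
    then have "d w a = Suc (d w a')"
      using a'(2) 1 d_step[OF a'(1), of w] d_sym[of a w] d_sym[of a u] d_sym[of a' w] d_sym[of a' u]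
      by linarith
    moreover have "d w a = Suc (d w b)" using 4 1 d_sym[of a w] d_sym[of a u] by linarith
    ultimately have "a' = b" by (rule closer_unique[OF a'(1) _ assms(2)])
    then show False using a'(2) 2 4 d_sym[of b w] d_sym[of b u] by simp
  qed
  then show ?thesis using 4 by simp
qed

lemma H_disjoint: "adj b a \<Longrightarrow> adj b c \<Longrightarrow> a \<noteq> c \<Longrightarrow> H b a \<inter> H b c = {}"
proof (rule equals0I)
  fix v assume a: "adj b a" "adj b c" "a \<noteq> c" "v \<in> H b a \<inter> H b c"
  then have "d v b = Suc (d v a)" "d v b = Suc (d v c)" using mem_H by auto
  with closer_unique[OF a(1) this(1) a(2) this(2)] a(3) show False by simp
qed

lemma H_step: "adj a b \<Longrightarrow> adj b c \<Longrightarrow> a \<noteq> c \<Longrightarrow> H b c \<subseteq> H a b"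
  using H_disjoint[of b a c] H_compl[of b a] adj_sym by blast

text \<open>A half-tree is connected, so it can only be cut by an edge it contains.\<close>
lemma H_uncut:
  assumes "adj u w" "adj a b" "\<not> (a \<in> H u w \<and> b \<in> H u w)" "v \<in> H u w"
  shows "v \<in> H a b \<longleftrightarrow> w \<in> H a b"
  using assms(4)
proof (induction "d w v" arbitrary: v)
  case 0
  then show ?case by simp
next
  case (Suc n)
  then have "w \<noteq> v" by auto
  then obtain z where z: "adj v z" "d w v = Suc (d w z)" using closer_exists by blast
  have "z \<in> H u w"
  proof (rule ccontr)
    assume "z \<notin> H u w"
    with H_crossing[OF assms(1) adj_sym[OF z(1)]] Suc.prems \<open>w \<noteq> v\<close> show False by auto
  qed
  then have "z \<in> H a b \<longleftrightarrow> w \<in> H a b" using Suc z by auto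
  moreover have "v \<in> H a b \<longleftrightarrow> z \<in> H a b"
    using H_crossing[OF assms(2) z(1)] H_crossing[OF assms(2) adj_sym[OF z(1)]]
      Suc.prems \<open>z \<in> H u w\<close> assms(3) by blast
  ultimately show ?case by simp
qed

lemma H_uncut': "adj u w \<Longrightarrow> adj a b \<Longrightarrow> \<not> (a \<in> H u w \<and> b \<in> H u w) \<Longrightarrow>
    H u w \<subseteq> H a b \<or> H u w \<inter> H a b = {}"
  using H_uncut by blast

text \<open>The edge bounding \<open>B\<close> cannot lie inside both \<open>A\<close> and its
  complement, so it leaves one of the two uncut.\<close>

lemma halftree_nested:
  assumes "A \<in> halftrees" "B \<in> halftrees"
  shows "A \<inter> B = {} \<or> A \<subseteq> B \<or> B \<subseteq> A \<or> A \<union> B = UNIV"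
proof -
  obtain u w where A: "adj u w" "A = H u w" using assms(1) by (rule halftreeE)
  obtain a b where B: "adj a b" "B = H a b" using assms(2) by (rule halftreeE)
  have "A \<subseteq> B \<or> A \<inter> B = {} \<or> - A \<subseteq> B \<or> - A \<inter> B = {}"
    using H_uncut'[OF A(1) B(1)] H_uncut'[OF adj_sym[OF A(1)] B(1)]
    unfolding A(2) B(2) H_compl[OF A(1), symmetric] by blast
  then show ?thesis by blast
qed

lemma halftree_nonempty: "A \<in> halftrees \<Longrightarrow> A \<noteq> {}"
  using in_H by (auto elim!: halftreeE)

text \<open>If all four intersections were non-empty, nestedness would put \<open>B1\<close> or
  \<open>B2\<close> inside \<open>A1\<close>, away from \<open>A2\<close>.\<close>

lemma halftrees_disjoint_pair:
  assumes "A1 \<in> halftrees" "A2 \<in> halftrees" "A1 \<inter> A2 = {}"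
    and "B1 \<in> halftrees" "B2 \<in> halftrees" "B1 \<inter> B2 = {}"
  obtains A B where "A \<in> {A1, A2}" "B \<in> {B1, B2}" "A \<inter> B = {}"
proof -
  have ne: "A1 \<noteq> {}" "A2 \<noteq> {}" "B1 \<noteq> {}" "B2 \<noteq> {}" using assms halftree_nonempty by auto
  have "A1 \<inter> B1 = {} \<or> A1 \<inter> B2 = {} \<or> A2 \<inter> B1 = {} \<or> A2 \<inter> B2 = {}"
  proof (rule ccontr)
    assume c: "\<not> ?thesis"
    have "B1 \<subseteq> A1 \<or> B2 \<subseteq> A1"
      using halftree_nested[OF assms(1,4)] halftree_nested[OF assms(1,5)] c assms(6) by blast
    then show False using c assms(3) by blast
  qed
  then show ?thesis using that by blast
qed

text \<open>A path from outside can enter only through \<open>w\<close>, which is therefore the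
  unique nearest point. The induction walks from \<open>x\<close> back towards \<open>p\<close>
  until it leaves the half-tree.\<close>

lemma H_gate:
  assumes "adj u w" "p \<notin> H u w" "x \<in> H u w"
  shows "d p w \<le> d p x" and "x \<noteq> w \<Longrightarrow> d p w < d p x"
proof -
  have "x \<in> H u w \<Longrightarrow> d p w \<le> d p x \<and> (x \<noteq> w \<longrightarrow> d p w < d p x)"
  proof (induction "d p x" arbitrary: x)
    case 0
    then show ?case using assms by auto
  next
    case (Suc n)
    then have "p \<noteq> x" by auto
    then obtain z where z: "adj x z" "d p x = Suc (d p z)" using closer_exists by blast
    show ?case
    proof (cases "z \<in> H u w")
      case True
      then show ?thesis using Suc z by force
    next
      case False
      then show ?thesis using H_crossing[OF assms(1) adj_sym[OF z(1)]] Suc by auto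
    qed
  qed
  with assms(3) show "d p w \<le> d p x" "x \<noteq> w \<Longrightarrow> d p w < d p x" by auto
qed

lemma H_convex:
  assumes "adj u w" "x \<in> H u w" "y \<in> H u w" "adj x z" "d y x = Suc (d y z)"
  shows "z \<in> H u w"
proof (rule ccontr)
  assume "z \<notin> H u w"
  then have "z = u \<and> x = w" using H_crossing[OF assms(1) adj_sym[OF assms(4)]] assms by blast
  then show False using assms mem_H by auto
qed

section \<open>Automorphisms\<close>

lemma aut_adj: "is_aut adj g \<Longrightarrow> adj (g x) (g y) \<longleftrightarrow> adj x y"
  and aut_bij: "is_aut adj g \<Longrightarrow> bij g"
  and aut_inj: "is_aut adj g \<Longrightarrow> g x = g y \<longleftrightarrow> x = y"
  by (auto simp: is_aut_def bij_def inj_eq)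

lemma d_aut: assumes "is_aut adj g" shows "d (g x) (g y) = d x y"
proof -
  have rp: "rpath (g x) (g y) (map g xs)" if "rpath x y xs" for xs
    using that assms by (auto simp: rpath_def walk_def reduced_def hd_map last_map aut_adj aut_inj)
  obtain xs where xs: "rpath x y xs" using rpath_exists by blast
  from d_eq[OF xs] d_eq[OF rp[OF xs]] show ?thesis by simp
qed

lemma H_aut: assumes "is_aut adj g" shows "g ` H u w = H (g u) (g w)"
proof
  show "g ` H u w \<subseteq> H (g u) (g w)" using d_aut[OF assms] by (auto simp: H_def)
  show "H (g u) (g w) \<subseteq> g ` H u w"
  proof
    fix y assume y: "y \<in> H (g u) (g w)"
    obtain x where "y = g x" using aut_bij[OF assms] by (metis bij_pointE)
    then show "y \<in> g ` H u w" using y d_aut[OF assms] by (auto simp: H_def)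
  qed
qed

lemma halftree_aut: "is_aut adj g \<Longrightarrow> A \<in> halftrees \<Longrightarrow> g ` A \<in> halftrees"
  by (metis halftreeE halftreeI H_aut aut_adj)

text \<open>Take a moved vertex, seen from a fixed vertex \<open>u\<close> adjacent to the half-tree:
  the half-trees behind it and behind its image are disjoint.\<close>
lemma displaced_halftree:
  assumes g: "is_aut adj g" and A: "A \<in> halftrees" and fix_out: "\<And>v. v \<notin> A \<Longrightarrow> g v = v" and "g \<noteq> id"
  obtains E where "E \<in> halftrees" "E \<subseteq> A" "g ` E \<inter> E = {}"
proof -
  obtain u w where uw: "adj u w" "A = H u w" using A by (rule halftreeE)
  have gu: "g u = u" using fix_out uw by auto
  obtain v where v: "g v \<noteq> v" using \<open>g \<noteq> id\<close> by fastforce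
  then have vA: "v \<in> H u w" using fix_out uw by auto
  then have "u \<noteq> v" by auto
  then obtain z where z: "adj v z" "d u v = Suc (d u z)" using closer_exists by blast
  have zv: "adj z v" using z adj_sym by blast
  define E where "E = H z v"
  have uE: "u \<notin> E" using z mem_H[OF zv] by (auto simp: E_def)
  have vE: "v \<in> E" using in_H zv by (simp add: E_def)
  have sub: "E \<subseteq> A" using H_uncut'[OF zv uw(1)] uE vA vE uw by (auto simp: E_def)
  have gz: "adj (g z) (g v)" using zv aut_adj g by simp
  have gE: "g ` E = H (g z) (g v)" using H_aut g E_def by simp
  have ugE: "u \<notin> g ` E" using uE gu aut_inj[OF g] by (metis imageE)
  have duv: "d u (g v) = d u v" using d_aut[OF g, of u v] gu by simp
  have Eh: "E \<in> halftrees" "g ` E \<in> halftrees" using halftreeI zv gz gE E_def by auto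
  have "g v \<notin> E" using H_gate(2)[OF zv, of u "g v"] uE duv v by (auto simp: E_def)
  moreover have "v \<notin> g ` E" using H_gate(2)[OF gz, of u v] ugE duv v unfolding gE by auto
  ultimately have "g ` E \<inter> E = {}"
    using halftree_nested[OF Eh(2) Eh(1)] vE uE ugE by blast
  with that Eh sub show ?thesis by blast
qed

section \<open>Rays and ends\<close>

lemma ray_tail: "ray adj r \<Longrightarrow> ray adj (\<lambda>n. r (n + k))"
  by (simp add: ray_def)

text \<open>At each vertex the unique neighbour nearer to the origin is the previous vertex, and a
  ray does not turn back.\<close>

lemma ray_d0: assumes "ray adj r" shows "d (r 0) (r n) = n"
proof (induction n rule: less_induct)
  case (less n)
  consider "n = 0" | "n = 1" | m where "n = Suc (Suc m)" by (metis One_nat_def old.nat.exhaust)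
  then show ?case
  proof cases
    case 2
    then show ?thesis using assms d_adj[of "r 0" "r 1"] by (simp add: ray_def)
  next
    case 3
    have a: "adj (r (Suc m)) (r m)" "adj (r (Suc m)) (r n)" "r m \<noteq> r n"
      using assms adj_sym 3 by (auto simp: ray_def)
    have e: "d (r 0) (r m) = m" "d (r 0) (r (Suc m)) = Suc m" using less 3 by auto
    have "d (r 0) (r (Suc m)) \<noteq> Suc (d (r 0) (r n))"
      using closer_unique[OF a(1) _ a(2)] e a(3) by metis
    then show ?thesis using d_step[OF a(2), of "r 0"] e 3 by simp
  qed simp
qed

lemma ray_d: assumes "ray adj r" shows "d (r m) (r (m + n)) = n"
  using ray_d0[OF ray_tail[OF assms, of m], of n] by (simp add: add.commute)

lemma ray_in_H: assumes "ray adj r" "n \<ge> 1" shows "r n \<in> H (r 0) (r 1)"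
  using ray_d0[OF assms(1), of n] ray_d[OF assms(1), of 1 "n - 1"] assms(2)
  by (simp add: H_def d_sym[of "r n"])

lemma ray_cons: "ray adj r \<Longrightarrow> adj x (r 0) \<Longrightarrow> x \<noteq> r 1 \<Longrightarrow> ray adj (case_nat x r)"
  by (auto simp: ray_def split: nat.splits)

lemma ray_end_of: "ray adj r \<Longrightarrow> r \<in> end_of adj r"
  unfolding end_of_def by auto

lemma end_of_subset:
  assumes "\<And>n. s (n + a) = r (n + b)"
  shows "end_of adj s \<subseteq> end_of adj r"
proof
  fix t assume "t \<in> end_of adj s"
  then obtain k m where t: "ray adj t" "\<And>n. t (n + k) = s (n + m)" unfolding end_of_def by auto
  have "t (n + (a + k)) = r (n + (b + m))" for n
    using t(2)[of "n + a"] assms[of "n + m"] by (simp add: ac_simps)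
  then show "t \<in> end_of adj r" using t(1) unfolding end_of_def by blast
qed

lemma end_of_eqI: "(\<And>n. s (n + a) = r (n + b)) \<Longrightarrow> end_of adj s = end_of adj r"
  using end_of_subset[of s a r b] end_of_subset[of r b s a] by auto

lemma end_of_tails: "s \<in> end_of adj r \<Longrightarrow> ray adj s \<and> (\<exists>a b. \<forall>n. s (n + a) = r (n + b))"
  unfolding end_of_def by blast

lemma end_of_eq: assumes "s \<in> end_of adj r" shows "end_of adj s = end_of adj r"
proof -
  obtain a b where "\<And>n. s (n + a) = r (n + b)" using end_of_tails[OF assms] by blast
  then show ?thesis by (rule end_of_eqI)
qed

text \<open>The starting point is moved along one edge at a time: the ray either loses its first
  vertex or gains a new one.\<close>

lemma end_of_from:
  assumes "ray adj r"
  obtains s where "s \<in> end_of adj r" "s 0 = x"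
proof -
  have "\<exists>s\<in>end_of adj r. s 0 = x"
    using connected[of "r 0" x]
  proof (induction rule: rtranclp_induct)
    case base
    then show ?case using ray_end_of[OF assms] by blast
  next
    case (step y z)
    then obtain s where s: "s \<in> end_of adj r" "s 0 = y" by blast
    then have rs: "ray adj s" using end_of_tails by blast
    show ?case
    proof (cases "s 1 = z")
      case True
      have "end_of adj (\<lambda>n. s (n + 1)) = end_of adj s" by (rule end_of_eqI[of _ 0 _ 1]) simp
      then show ?thesis
        using True ray_end_of[OF ray_tail[OF rs, of 1]] end_of_eq[OF s(1)]
        by (intro bexI[of _ "\<lambda>n. s (n + 1)"]) auto
    next
      case False
      let ?t = "case_nat z s"
      have "ray adj ?t" using ray_cons[OF rs, of z] False s step adj_sym by auto
      moreover have "end_of adj ?t = end_of adj s" by (rule end_of_eqI[of _ 1 _ 0]) simp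
      ultimately show ?thesis using ray_end_of[of ?t] end_of_eq[OF s(1)]
        by (intro bexI[of _ ?t]) auto
    qed
  qed
  with that show ?thesis by blast
qed

lemma end_of_agree:
  assumes "ray adj r" "ray adj s" "s \<in> end_of adj r" "s 0 = r 0"
  shows "s = r"
proof -
  \<comment> \<open>Rays with different first steps stay in disjoint half-trees and so cannot share
    a tail.\<close>
  have first: "s 1 = r 1" if "ray adj r" "ray adj s" "s 0 = r 0" "\<And>n. s (n + a) = r (n + b)"
    for r s :: "nat \<Rightarrow> 'v" and a b
  proof (rule ccontr)
    assume n: "s 1 \<noteq> r 1"
    have a: "adj (s 0) (s 1)" "adj (s 0) (r 1)" using that by (metis One_nat_def ray_def)+
    have "s (1 + a) \<in> H (s 0) (s 1)" "r (1 + b) \<in> H (s 0) (r 1)"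
      using ray_in_H[OF that(1), of "1 + b"] ray_in_H[OF that(2), of "1 + a"] that(3) by auto
    then show False using that(4)[of 1] H_disjoint[OF a n] by auto
  qed
  obtain a b where ab: "\<And>n. s (n + a) = r (n + b)" using assms(3) end_of_tails by blast
  \<comment> \<open>The common tail begins at distance \<open>a\<close> from the start of one ray
    and at distance \<open>b\<close> from that of the other, and both start at the same
    vertex.\<close>
  have "a = b" using ray_d0[OF assms(2), of a] ray_d0[OF assms(1), of b] ab[of 0] assms(4) by simp
  have "s n = r n" for n
  proof (induction n)
    case 0
    then show ?case using assms by simp
  next
    case (Suc n)
    have "(\<lambda>i. s (i + n)) 1 = (\<lambda>i. r (i + n)) 1"
    proof (rule first[where a = a and b = b])
      show "s (i + a + n) = r (i + b + n)" for i
        using ab[of "i + n"] by (simp add: ac_simps)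
    qed (use ray_tail assms Suc in auto)
    then show ?case by simp
  qed
  then show ?thesis by blast
qed

lemma ends_ray: assumes "\<xi> \<in> ends adj" obtains r where "ray adj r" "\<xi> = end_of adj r"
  using assms unfolding ends_def by blast

lemma end_of_ends: "ray adj r \<Longrightarrow> end_of adj r \<in> ends adj"
  unfolding ends_def by blast

lemma shadowE:
  assumes "\<xi> \<in> shadow adj u w"
  obtains r where "ray adj r" "\<xi> = end_of adj r" "r 0 = u" "r 1 = w"
proof -
  obtain r r0 where "r \<in> \<xi>" "r 0 = u" "r 1 = w" "ray adj r0" "\<xi> = end_of adj r0"
    using assms ends_ray unfolding shadow_def by blast
  then show ?thesis using that end_of_eq end_of_tails by metis
qed

lemma shadowI: "ray adj r \<Longrightarrow> end_of adj r \<in> shadow adj (r 0) (r 1)"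
  unfolding shadow_def using ray_end_of end_of_ends by blast

lemma shadow_eventually:
  assumes "ray adj r" "end_of adj r \<in> shadow adj u w"
  obtains N where "\<And>n. n \<ge> N \<Longrightarrow> r n \<in> H u w"
proof -
  obtain s where s: "ray adj s" "end_of adj r = end_of adj s" "s 0 = u" "s 1 = w"
    using assms(2) by (rule shadowE)
  then obtain a b where ab: "\<And>n. r (n + a) = s (n + b)" using ray_end_of[OF assms(1)] end_of_tails by metis
  show ?thesis
  proof (rule that[of "a + 1"])
    fix n assume n: "a + 1 \<le> n"
    have "r n = s (n - a + b)" using ab[of "n - a"] n by simp
    then show "r n \<in> H u w" using ray_in_H[OF s(1), of "n - a + b"] s n by simp
  qed
qed

text \<open>Seen from \<open>u\<close>, a ray finally stays behind one neighbour of
  \<open>u\<close>; meeting \<open>H u w\<close> arbitrarily late singles out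
  \<open>w\<close>.\<close>

lemma shadow_frequently:
  assumes "ray adj r" "adj u w" "\<And>N. \<exists>n\<ge>N. r n \<in> H u w"
  shows "end_of adj r \<in> shadow adj u w"
proof -
  obtain s where s: "s \<in> end_of adj r" "s 0 = u" using end_of_from[OF assms(1)] by blast
  then have rs: "ray adj s" "end_of adj s = end_of adj r" using end_of_tails end_of_eq by blast+
  then have sh: "end_of adj r \<in> shadow adj u (s 1)" using shadowI[OF rs(1)] s by simp
  obtain N where N: "\<And>n. n \<ge> N \<Longrightarrow> r n \<in> H u (s 1)" using shadow_eventually[OF assms(1) sh] by blast
  obtain n where "n \<ge> N" "r n \<in> H u w" using assms(3) by blast
  moreover have "adj u (s 1)" using rs(1) s by (metis One_nat_def ray_def)
  ultimately have "s 1 = w" using N[of n] H_disjoint[OF assms(2), of "s 1"] by blast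
  then show ?thesis using sh by simp
qed

lemma shadow_unique:
  assumes "\<xi> \<in> shadow adj u w" "\<xi> \<in> shadow adj u w'" shows "w = w'"
proof -
  obtain r where r: "ray adj r" "\<xi> = end_of adj r" "r 0 = u" "r 1 = w" using assms(1) by (rule shadowE)
  obtain s where s: "ray adj s" "\<xi> = end_of adj s" "s 0 = u" "s 1 = w'" using assms(2) by (rule shadowE)
  have "s \<in> end_of adj r" using ray_end_of[OF s(1)] r s by simp
  then have "s = r" using end_of_agree[OF r(1) s(1)] r s by simp
  then show ?thesis using r s by simp
qed

lemma shadow_mono:
  assumes "adj a b" "H u w \<subseteq> H a b" shows "shadow adj u w \<subseteq> shadow adj a b"
proof
  fix \<xi> assume x: "\<xi> \<in> shadow adj u w"
  then obtain r where r: "ray adj r" "\<xi> = end_of adj r" by (rule shadowE)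
  obtain N where "\<And>n. n \<ge> N \<Longrightarrow> r n \<in> H u w" using shadow_eventually[OF r(1)] x r by blast
  then show "\<xi> \<in> shadow adj a b"
    using shadow_frequently[OF r(1) assms(1)] assms(2) r(2) by (metis max.cobounded1 max.cobounded2 subsetD)
qed

lemma aut_inv: "is_aut adj g \<Longrightarrow> is_aut adj (inv g)"
  unfolding is_aut_def by (metis bij_imp_bij_inv bij_inv_eq_iff)

lemma ray_aut: "is_aut adj g \<Longrightarrow> ray adj r \<Longrightarrow> ray adj (g \<circ> r)"
  by (auto simp: ray_def aut_adj aut_inj)

lemma end_act_end_of:
  assumes "is_aut adj g" shows "end_act g (end_of adj r) = end_of adj (g \<circ> r)"
proof
  show "end_act g (end_of adj r) \<subseteq> end_of adj (g \<circ> r)"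
  proof
    fix t assume "t \<in> end_act g (end_of adj r)"
    then obtain s where s: "t = g \<circ> s" "s \<in> end_of adj r" unfolding end_act_def by blast
    then obtain a b where "ray adj s" "\<And>n. s (n + a) = r (n + b)" using end_of_tails by blast
    then have "ray adj t" "t (n + a) = (g \<circ> r) (n + b)" for n using ray_aut[OF assms] s(1) by auto
    then show "t \<in> end_of adj (g \<circ> r)" unfolding end_of_def by blast
  qed
  show "end_of adj (g \<circ> r) \<subseteq> end_act g (end_of adj r)"
  proof
    fix t assume "t \<in> end_of adj (g \<circ> r)"
    then obtain a b where t: "ray adj t" "\<And>n. t (n + a) = g (r (n + b))" using end_of_tails by fastforce
    let ?s = "inv g \<circ> t"
    have "ray adj ?s" using ray_aut[OF aut_inv[OF assms] t(1)] .
    moreover have "?s (n + a) = r (n + b)" for n using t(2) aut_bij[OF assms] by (simp add: bij_is_inj)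
    ultimately have "?s \<in> end_of adj r" unfolding end_of_def by blast
    moreover have "t = g \<circ> ?s" using aut_bij[OF assms] by (auto simp: bij_is_surj surj_f_inv_f)
    ultimately show "t \<in> end_act g (end_of adj r)" unfolding end_act_def by blast
  qed
qed

lemma shadow_aut:
  assumes "is_aut adj g" "\<xi> \<in> shadow adj u w" shows "end_act g \<xi> \<in> shadow adj (g u) (g w)"
proof -
  obtain r where r: "ray adj r" "\<xi> = end_of adj r" "r 0 = u" "r 1 = w" using assms(2) by (rule shadowE)
  then show ?thesis using shadowI[OF ray_aut[OF assms(1) r(1)]] end_act_end_of[OF assms(1)] by simp
qed

text \<open>The edge from \<open>v\<close> to \<open>x\<close> points away from \<open>v'\<close>,
  so everything behind it is seen from \<open>v'\<close> through the first edge of the path back to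
  \<open>v\<close>.\<close>

lemma shadow_turn:
  assumes "adj v w" "v' \<in> H v w" "adj v' w'" "d v v' = Suc (d v w')"
    and "adj v x" "x \<noteq> w" "\<xi> \<in> shadow adj v x"
  shows "\<xi> \<in> shadow adj v' w'"
proof -
  have v': "v' \<notin> H v x" using H_disjoint[OF assms(1,5)] assms(2,6) by blast
  have v: "v \<in> H v' w'" using assms(4) mem_H[OF assms(3)] by simp
  have "x \<in> H v' w'"
  proof (rule ccontr)
    assume "x \<notin> H v' w'"
    then have "x = v'" using H_crossing[OF assms(3) adj_sym[OF assms(5)]] v by blast
    then show False using v' in_H[OF assms(5)] by blast
  qed
  then have "H v x \<subseteq> H v' w'"
    using H_uncut'[OF assms(5,3)] v' in_H[OF assms(5)] by blast
  then show ?thesis using shadow_mono[OF assms(3)] assms(7) by blast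
qed

text \<open>\<open>v\<close> is the median of three fixed ends. If it were moved, every end that
  leaves \<open>v\<close> in a direction other than \<open>w\<close> would leave \<open>g v\<close>
  through \<open>w'\<close>, and also through the image of its own direction at \<open>v\<close>. At
  least two of the three ends are of this kind, but their directions have distinct images.\<close>

lemma fixed_median:
  assumes g: "is_aut adj g"
    and x: "adj v x1" "adj v x2" "adj v x3" "x1 \<noteq> x2" "x1 \<noteq> x3" "x2 \<noteq> x3"
    and sh: "\<xi>1 \<in> shadow adj v x1" "\<xi>2 \<in> shadow adj v x2" "\<xi>3 \<in> shadow adj v x3"
    and fx: "end_act g \<xi>1 = \<xi>1" "end_act g \<xi>2 = \<xi>2" "end_act g \<xi>3 = \<xi>3"
  shows "g v = v"
proof (rule ccontr)
  assume n: "g v \<noteq> v"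
  obtain w where w: "adj v w" "d (g v) v = Suc (d (g v) w)" using closer_exists[OF n] by blast
  obtain w' where w': "adj (g v) w'" "d v (g v) = Suc (d v w')" using closer_exists n by metis
  have gv: "g v \<in> H v w" using w mem_H by simp
  have *: "x = w \<or> g x = w'" if "adj v x" "\<xi> \<in> shadow adj v x" "end_act g \<xi> = \<xi>" for x \<xi>
    using shadow_turn[OF w(1) gv w' that(1) _ that(2)] shadow_aut[OF g that(2)] that(3) shadow_unique
    by metis
  show False using *[OF x(1) sh(1) fx(1)] *[OF x(2) sh(2) fx(2)] *[OF x(3) sh(3) fx(3)] x(4-6)
    aut_inj[OF g] by metis
qed

text \<open>Every vertex of \<open>H a b\<close> lies on a ray from \<open>p\<close> to a fixed end, and \<open>g\<close> fixes such a ray pointwise.\<close>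
lemma fixed_halftree:
  assumes g: "is_aut adj g" and uw: "adj u w" and ab: "adj a b" and sub: "H a b \<subseteq> H u w"
    and p: "g p = p" "p \<notin> H a b"
    and fx: "\<And>\<xi>. \<xi> \<in> shadow adj u w \<Longrightarrow> end_act g \<xi> = \<xi>"
    and ne: "\<And>z v. adj z v \<Longrightarrow> shadow adj z v \<noteq> {}"
    and v: "v \<in> H a b"
  shows "g v = v"
proof -
  have "p \<noteq> v" using p v by blast
  then obtain z where z: "adj v z" "d p v = Suc (d p z)" using closer_exists by blast
  then have zv: "adj z v" using adj_sym by blast
  have pz: "p \<notin> H z v" using z mem_H[OF zv] by simp
  have "H z v \<subseteq> H a b"
  proof (cases "b \<in> H z v")
    case True
    have "d p b \<le> d p v" using H_gate(1)[OF ab p(2) v] .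
    then have "b = v" using H_gate(2)[OF zv pz True] by linarith
    moreover have "d p b = Suc (d p a)" using p(2) mem_H[OF ab, of p] d_step[OF ab, of p] by auto
    ultimately have "a = z" using closer_unique[of v a p z] z ab adj_sym by blast
    then show ?thesis using \<open>b = v\<close> by simp
  next
    case False
    then show ?thesis using H_uncut'[OF zv ab] v in_H[OF zv] by blast
  qed
  then have sh: "shadow adj z v \<subseteq> shadow adj u w" using shadow_mono[OF uw] sub by blast
  obtain \<xi> where xi: "\<xi> \<in> shadow adj z v" using ne[OF zv] by blast
  then obtain r0 where r0: "ray adj r0" "\<xi> = end_of adj r0" by (rule shadowE)
  obtain r where r: "r \<in> end_of adj r0" "r 0 = p" using end_of_from[OF r0(1)] by blast
  then have rr: "ray adj r" "end_of adj r = \<xi>" using end_of_tails end_of_eq r0(2) by blast+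
  have "end_of adj (g \<circ> r) = end_of adj r"
    using fx[of \<xi>] sh xi end_act_end_of[OF g, of r] rr(2) by auto
  then have "g \<circ> r \<in> end_of adj r" using ray_end_of[OF ray_aut[OF g rr(1)]] by simp
  then have gr: "g \<circ> r = r" using end_of_agree[OF rr(1) ray_aut[OF g rr(1)]] r(2) p(1) by simp
  obtain N where N: "\<And>n. n \<ge> N \<Longrightarrow> r n \<in> H z v"
    using shadow_eventually[OF rr(1)] xi rr(2) by blast
  define m where "m = (LEAST n. r n \<in> H z v)"
  have m: "r m \<in> H z v" unfolding m_def by (rule LeastI[of _ N]) (use N in blast)
  then have "m \<noteq> 0" using pz r(2) by metis
  then obtain m' where m': "m = Suc m'" using not0_implies_Suc by blast
  have "r m' \<notin> H z v" using not_less_Least[of m' "\<lambda>n. r n \<in> H z v"] m' m_def by simp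
  moreover have "adj (r m') (r m)" using rr(1) m' by (simp add: ray_def)
  ultimately have "r m = v" using H_crossing[OF zv] m by blast
  then show ?thesis using gr by (metis comp_apply)
qed

section \<open>Lines\<close>

lemma line_shift: "line adj l \<Longrightarrow> line adj (\<lambda>i. l (i + c))"
  unfolding line_def by (metis (no_types, opaque_lifting) add.assoc add.commute)

lemma line_rev: assumes "line adj l" shows "line adj (\<lambda>i. l (- i))"
  unfolding line_def
proof (intro allI conjI)
  fix i :: int
  have "adj (l (- i - 1)) (l (- i - 1 + 1))" "l (- i - 2) \<noteq> l (- i - 2 + 2)"
    using assms unfolding line_def by blast+
  then show "adj (l (- i)) (l (- (i + 1)))" "l (- i) \<noteq> l (- (i + 2))"
    using adj_sym[of "l (- i - 1)"] by (simp_all add: algebra_simps minus_diff_commute)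
qed

lemma line_ray: assumes "line adj l" shows "ray adj (\<lambda>n. l (c + int n))"
  unfolding ray_def
proof (intro allI conjI)
  fix n
  have "adj (l (c + int n)) (l (c + int n + 1))" "l (c + int n) \<noteq> l (c + int n + 2)"
    using assms unfolding line_def by blast+
  then show "adj (l (c + int n)) (l (c + int (Suc n)))" "l (c + int n) \<noteq> l (c + int (Suc (Suc n)))"
    by (simp_all add: algebra_simps)
qed

lemma line_d: assumes "line adj l" shows "d (l i) (l j) = nat \<bar>i - j\<bar>"
proof -
  have *: "d (l i) (l j) = nat (j - i)" if "i \<le> j" for i j
    using ray_d0[OF line_ray[OF assms, of i], of "nat (j - i)"] that by simp
  show ?thesis using *[of i j] *[of j i] d_sym[of "l i" "l j"] by (cases "i \<le> j") auto
qed

lemma line_adj: "line adj l \<Longrightarrow> adj (l i) (l (i + 1))" "line adj l \<Longrightarrow> adj (l (i + 1)) (l i)"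
  using adj_sym by (auto simp: line_def)

lemma line_inj: "line adj l \<Longrightarrow> l i = l j \<longleftrightarrow> i = j"
  using line_d[of l i j] d_zero[of "l i" "l j"] by auto

lemma line_mem_H: assumes "line adj l" shows "l k \<in> H (l i) (l (i + 1)) \<longleftrightarrow> i < k"
  and "l k \<in> H (l (i + 1)) (l i) \<longleftrightarrow> k \<le> i"
  unfolding H_def using line_d[OF assms] by auto

lemma line_H_mono:
  assumes "line adj l" "i \<le> j" shows "H (l j) (l (j + 1)) \<subseteq> H (l i) (l (i + 1))"
    and "H (l (i + 1)) (l i) \<subseteq> H (l (j + 1)) (l j)"
proof -
  have "l i \<notin> H (l j) (l (j + 1))" "l (j + 1) \<in> H (l i) (l (i + 1))"
    "l (j + 1) \<in> H (l j) (l (j + 1))" using assms line_mem_H by auto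
  then show 1: "H (l j) (l (j + 1)) \<subseteq> H (l i) (l (i + 1))"
    using H_uncut'[OF line_adj(1)[OF assms(1)] line_adj(1)[OF assms(1)], of i j] by blast
  show "H (l (i + 1)) (l i) \<subseteq> H (l (j + 1)) (l j)"
    using 1 H_compl[OF line_adj(1)[OF assms(1)]] by blast
qed

text \<open>Otherwise the distance from \<open>x\<close> would drop forever along the line in the
  negative direction.\<close>

lemma line_escape:
  assumes "line adj l" obtains m where "\<And>i. i \<le> m \<Longrightarrow> x \<notin> H (l (i + 1)) (l i)"
proof -
  have "\<exists>i. x \<notin> H (l (i + 1)) (l i)"
  proof (rule ccontr)
    assume "\<not> ?thesis"
    then have a: "d x (l (i + 1)) = Suc (d x (l i))" for i
      using mem_H[OF line_adj(2)[OF assms]] by blast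
    have "d x (l (- int n)) + n = d x (l 0)" for n
    proof (induction n)
      case (Suc n)
      then show ?case using a[of "- int (Suc n)"] by simp
    qed simp
    from this[of "Suc (d x (l 0))"] show False by linarith
  qed
  then obtain m where "x \<notin> H (l (m + 1)) (l m)" by blast
  then show ?thesis using that line_H_mono(2)[OF assms] by blast
qed

lemma line_nearest:
  fixes l :: "int \<Rightarrow> 'v"
  obtains j where "\<And>i. d x (l j) \<le> d x (l i)"
proof -
  define N where "N = (LEAST n. n \<in> range (\<lambda>i. d x (l i)))"
  have "N \<in> range (\<lambda>i. d x (l i))" unfolding N_def by (rule LeastI[of _ "d x (l 0)"]) blast
  then obtain j where j: "N = d x (l j)" by blast
  have "N \<le> d x (l i)" for i unfolding N_def by (rule Least_le) blast
  then show ?thesis using that[of j] j by simp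
qed

lemma line_gate:
  assumes "line adj l" "\<And>i. d x (l j) \<le> d x (l i)"
  shows "x \<notin> H (l j) (l (j + 1))" "x \<notin> H (l j) (l (j - 1))"
  using assms(2)[of "j + 1"] assms(2)[of "j - 1"] by (auto simp: H_def)

lemma translates_shift:
  "translates adj g l k \<Longrightarrow> translates adj g (\<lambda>i. l (i + c)) k"
  unfolding translates_def using line_shift[of l c] by (auto simp: algebra_simps)

lemma translates_rev:
  assumes "is_aut adj g" "translates adj g l k" shows "translates adj (inv g) (\<lambda>i. l (- i)) k"
proof -
  have "inv g (l (- i)) = l (- (i + k))" for i
  proof -
    have "g (l (- (i + k))) = l (- i)" using assms(2) by (simp add: translates_def)
    then show ?thesis using aut_bij[OF assms(1)] by (metis bij_inv_eq_iff)
  qed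
  then show ?thesis using assms line_rev unfolding translates_def by auto
qed

lemma line_aut: "is_aut adj q \<Longrightarrow> line adj l \<Longrightarrow> line adj (q \<circ> l)"
  by (auto simp: line_def aut_adj aut_inj)

lemma translates_conj:
  assumes "is_aut adj q" "translates adj g l k"
  shows "translates adj (q \<circ> g \<circ> inv q) (q \<circ> l) k"
  using assms line_aut[OF assms(1)] aut_bij[OF assms(1)]
  by (auto simp: translates_def bij_is_inj)

lemma translates_funpow:
  assumes "translates adj g l k" shows "(g ^^ n) (l i) = l (i + int n * k)"
  using assms by (induction n) (auto simp: translates_def algebra_simps)

lemma translates_hyperbolic_endpoint:
  assumes "translates adj g l k"
  shows "end_of adj (\<lambda>n. l (c + int n)) \<in> endpoints adj g"
    "end_of adj (\<lambda>n. l (c - int n)) \<in> endpoints adj g"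
proof -
  have "translates adj g (\<lambda>i. l (i + c)) k" using assms translates_shift by blast
  moreover have "(\<lambda>n. l (c + int n)) = (\<lambda>n. (\<lambda>i. l (i + c)) (int n))"
    "(\<lambda>n. l (c - int n)) = (\<lambda>n. (\<lambda>i. l (i + c)) (- int n))" by (simp_all add: algebra_simps)
  ultimately show "end_of adj (\<lambda>n. l (c + int n)) \<in> endpoints adj g"
    "end_of adj (\<lambda>n. l (c - int n)) \<in> endpoints adj g"
    unfolding endpoints_def by (auto intro!: exI[of _ "\<lambda>i. l (i + c)"] exI[of _ k])
qed

text \<open>Far out in the negative direction the half-trees no longer contain \<open>l' 0\<close>.
  To enter them \<open>l'\<close> must cross their bounding edges, which lie on \<open>l\<close>, so
  it passes through every \<open>l i\<close> with \<open>i\<close> small. The two alternatives in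
  the conclusion are the two orientations of \<open>l'\<close>.\<close>

lemma line_common_end:
  assumes l: "line adj l" and l': "line adj l'"
    and enters: "\<And>i. range l' \<inter> H (l (i + 1)) (l i) \<noteq> {}"
  obtains c c' where "(\<forall>n. l' (c + int n) = l (c' - int n)) \<or> (\<forall>n. l' (c - int n) = l (c' - int n))"
proof -
  obtain m where m: "\<And>i. i \<le> m \<Longrightarrow> l' 0 \<notin> H (l (i + 1)) (l i)" using line_escape[OF l] by blast
  have ex: "\<exists>p. l' p = l i" if "i \<le> m" for i
  proof -
    obtain j where j: "l' j \<in> H (l (i + 1)) (l i)" using enters by blast
    have aux: "\<exists>n. line adj f \<longrightarrow> f (int n) = l i" if "f 0 \<notin> H (l (i + 1)) (l i)" "f (int n0) \<in> H (l (i + 1)) (l i)" for f n0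
    proof -
      define n where "n = (LEAST n. f (int n) \<in> H (l (i + 1)) (l i))"
      have n: "f (int n) \<in> H (l (i + 1)) (l i)" unfolding n_def using that(2) by (rule LeastI)
      have "n \<noteq> 0" using n that(1) by (metis of_nat_0)
      then obtain n' where n': "n = Suc n'" using not0_implies_Suc by blast
      have "f (int n') \<notin> H (l (i + 1)) (l i)"
        using not_less_Least[of n' "\<lambda>n. f (int n) \<in> H (l (i + 1)) (l i)"] n' n_def by simp
      moreover have "int n = int n' + 1" using n' by simp
      ultimately show ?thesis using H_crossing[OF line_adj(2)[OF l]] line_adj(1) n by metis
    qed
    show ?thesis
    proof (cases "j \<ge> 0")
      case True
      then show ?thesis using aux[of l' "nat j"] m[OF that] j l' by auto
    next
      case False
      then show ?thesis using aux[of "\<lambda>i. l' (- i)" "nat (- j)"] m[OF that] j line_rev[OF l'] by auto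
    qed
  qed
  then obtain p where p: "\<And>i. i \<le> m \<Longrightarrow> l' (p i) = l i" by metis
  \<comment> \<open>The positions on \<open>l'\<close> depend isometrically on those on
    \<open>l\<close>, so \<open>p\<close> is affine with slope 1 or -1; \<open>e\<close> records the
    sign when moving in the negative direction.\<close>
  have diff: "\<bar>p i - p j\<bar> = \<bar>i - j\<bar>" if "i \<le> m" "j \<le> m" for i j
    using line_d[OF l', of "p i" "p j"] line_d[OF l, of i j] p that by auto
  define e where "e = p (m - 1) - p m"
  have e: "e = 1 \<or> e = - 1" using diff[of "m - 1" m] unfolding e_def by auto
  have pn: "p (m - int n) = p m + e * int n" for n
  proof (cases "n = 0")
    case False
    then have "\<bar>p (m - int n) - p m\<bar> = int n" "\<bar>p (m - int n) - p (m - 1)\<bar> = int n - 1"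
      using diff[of "m - int n" m] diff[of "m - int n" "m - 1"] by auto
    then have "e = 1 \<Longrightarrow> p (m - int n) = p m + int n" "e = - 1 \<Longrightarrow> p (m - int n) = p m - int n"
      unfolding e_def by linarith+
    then show ?thesis using e by auto
  qed simp
  have "l' (p m + e * int n) = l (m - int n)" for n using p[of "m - int n"] pn[of n] by simp
  then have "(\<forall>n. l' (p m + int n) = l (m - int n)) \<or> (\<forall>n. l' (p m - int n) = l (m - int n))"
    using e by auto
  then show ?thesis using that by blast
qed

lemma line_end_indep: "end_of adj (\<lambda>n. l (c - int n)) = end_of adj (\<lambda>n. l (c' - int n))"
  by (rule end_of_eqI[of _ "nat (c - c')" _ "nat (c' - c)"]) (auto intro!: arg_cong[of _ _ l])

text \<open>\<open>l j\<close> is the point of the line nearest to \<open>u\<close>, where the path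
  from \<open>u\<close> arrives. The half-trees in both directions of the line miss
  \<open>u\<close>, so the edge from \<open>u\<close> to \<open>w\<close> does not cut them.\<close>

lemma line_branch:
  assumes "adj u w" "line adj l" "range l \<subseteq> H u w"
  obtains j where "H (l j) (l (j + 1)) \<subseteq> H u w" "H (l j) (l (j - 1)) \<subseteq> H u w"
    "u \<notin> H (l j) (l (j + 1))" "u \<notin> H (l j) (l (j - 1))"
proof -
  obtain j where j: "\<And>i. d u (l j) \<le> d u (l i)" using line_nearest by blast
  note nu = line_gate[OF assms(2) j]
  have a: "adj (l j) (l (j + 1))" "adj (l j) (l (j - 1))"
    using line_adj[OF assms(2)] line_adj(2)[OF assms(2), of "j - 1"] by auto
  have "H (l j) (l (j + 1)) \<subseteq> H u w" "H (l j) (l (j - 1)) \<subseteq> H u w"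
    using H_uncut'[OF a(1) assms(1)] H_uncut'[OF a(2) assms(1)] nu in_H[OF a(1)] in_H[OF a(2)] assms(3)
    by blast+
  with nu that show ?thesis by blast
qed

section \<open>Shadows as a base of the boundary topology\<close>

lemma ray_H_mono: assumes "ray adj r" shows "H (r n) (r (Suc n)) \<subseteq> H (r 0) (r 1)"
proof (induction n)
  case (Suc n)
  have "H (r (Suc n)) (r (Suc (Suc n))) \<subseteq> H (r n) (r (Suc n))"
    using assms by (intro H_step) (auto simp: ray_def)
  with Suc show ?case by blast
qed simp

text \<open>Two rays to the same end share a tail; the shadow of the first edge of such a tail lies
  in both given shadows. So the generating sets are a base and not merely a subbase.\<close>

lemma shadow_Int:
  assumes "\<xi> \<in> shadow adj u w" "\<xi> \<in> shadow adj u' w'" "adj u w" "adj u' w'"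
  obtains a b where "adj a b" "\<xi> \<in> shadow adj a b" "shadow adj a b \<subseteq> shadow adj u w \<inter> shadow adj u' w'"
proof -
  obtain r where r: "ray adj r" "\<xi> = end_of adj r" "r 0 = u" "r 1 = w" using assms(1) by (rule shadowE)
  obtain s where s: "ray adj s" "\<xi> = end_of adj s" "s 0 = u'" "s 1 = w'" using assms(2) by (rule shadowE)
  have "s \<in> end_of adj r" using ray_end_of[OF s(1)] s(2) r(2) by simp
  then obtain b a where ab: "\<And>n. s (n + b) = r (n + a)" using end_of_tails by blast
  have e: "s b = r a" "s (Suc b) = r (Suc a)" using ab[of 0] ab[of 1] by auto
  have "H (r a) (r (Suc a)) \<subseteq> H u w" "H (r a) (r (Suc a)) \<subseteq> H u' w'"
    using ray_H_mono[OF r(1), of a] ray_H_mono[OF s(1), of b] e r s by auto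
  then have 1: "shadow adj (r a) (r (Suc a)) \<subseteq> shadow adj u w \<inter> shadow adj u' w'"
    using shadow_mono assms(3,4) by blast
  have "end_of adj (\<lambda>n. r (n + a)) = \<xi>" unfolding r(2) by (rule end_of_eqI[of _ 0 _ a]) simp
  then have "\<xi> \<in> shadow adj (r a) (r (Suc a))" using shadowI[OF ray_tail[OF r(1), of a]] by simp
  moreover have "adj (r a) (r (Suc a))" using r(1) by (simp add: ray_def)
  ultimately show ?thesis using that 1 by blast
qed

lemma boundary_basis:
  assumes "openin (boundary_topology adj) U" "\<xi> \<in> U"
  obtains u w where "adj u w" "\<xi> \<in> shadow adj u w" "shadow adj u w \<subseteq> U"
proof -
  let ?S = "(\<lambda>(u, w). shadow adj u w) ` {(u, w). adj u w}"
  have "generate_topology_on ?S U"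
    using assms(1) openin_topology_generated_by_iff[of ?S U] unfolding boundary_topology_def by simp
  then have "\<forall>\<xi>\<in>U. \<exists>u w. adj u w \<and> \<xi> \<in> shadow adj u w \<and> shadow adj u w \<subseteq> U"
  proof induction
    case (Int A B)
    show ?case
    proof
      fix \<xi> assume "\<xi> \<in> A \<inter> B"
      then obtain u w u' w' where *: "adj u w" "\<xi> \<in> shadow adj u w" "shadow adj u w \<subseteq> A"
        "adj u' w'" "\<xi> \<in> shadow adj u' w'" "shadow adj u' w' \<subseteq> B" using Int.IH by blast
      then obtain a b where "adj a b" "\<xi> \<in> shadow adj a b"
        "shadow adj a b \<subseteq> shadow adj u w \<inter> shadow adj u' w'" using shadow_Int by metis
      then show "\<exists>u w. adj u w \<and> \<xi> \<in> shadow adj u w \<and> shadow adj u w \<subseteq> A \<inter> B" using * by blast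
    qed
  next
    case (UN K)
    then show ?case by blast
  qed auto
  then show ?thesis using assms(2) that by blast
qed

end

section \<open>Minimal actions of general type\<close>

locale tree_group = tree adj for adj :: "'v \<Rightarrow> 'v \<Rightarrow> bool" +
  fixes G :: "('v \<Rightarrow> 'v) set"
  assumes subgroup: "aut_subgroup adj G"
    and minimal: "minimal_action adj G"
    and general: "general_type adj G"
begin

lemma G_aut: "g \<in> G \<Longrightarrow> is_aut adj g"
  and G_id: "id \<in> G"
  and G_comp: "g \<in> G \<Longrightarrow> h \<in> G \<Longrightarrow> g \<circ> h \<in> G"
  and G_inv: "g \<in> G \<Longrightarrow> inv g \<in> G"
  using subgroup unfolding aut_subgroup_def by auto

lemma G_bij: "g \<in> G \<Longrightarrow> bij g"
  using G_aut aut_bij by blast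

lemma G_funpow: "g \<in> G \<Longrightarrow> g ^^ n \<in> G"
  by (induction n) (auto simp: G_id G_comp)

lemma G_halftree: "g \<in> G \<Longrightarrow> A \<in> halftrees \<Longrightarrow> g ` A \<in> halftrees"
  using G_aut halftree_aut by blast

lemma G_H: "g \<in> G \<Longrightarrow> g ` H u w = H (g u) (g w)"
  using G_aut H_aut by blast

text \<open>The vertices whose orbits avoid \<open>A\<close> form an invariant set, convex because
  the complement of \<open>A\<close> is a half-tree. If it were non-empty, it would be an invariant
  subtree missing \<open>w\<close>, against minimality.\<close>

lemma orbit_meets_halftree:
  assumes "A \<in> halftrees" obtains q where "q \<in> G" "q v \<in> A"
proof -
  obtain u w where uw: "adj u w" "A = H u w" using assms by (rule halftreeE)
  define M where "M = {x. \<forall>q\<in>G. q x \<notin> A}"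
  have "v \<notin> M"
  proof
    assume v: "v \<in> M"
    have step: "z \<in> M" if "x \<in> M" "y \<in> M" "adj x z" "d y x = Suc (d y z)" for x y z
      unfolding M_def
    proof (intro CollectI ballI)
      fix q assume q: "q \<in> G"
      note a = G_aut[OF q]
      have "q x \<in> H w u" "q y \<in> H w u"
        using that q H_compl[OF uw(1)] uw(2) unfolding M_def by auto
      then have "q z \<in> H w u"
        by (rule H_convex[OF adj_sym[OF uw(1)]]) (use that aut_adj[OF a] d_aut[OF a] in auto)
      then show "q z \<notin> A" using H_compl[OF uw(1)] uw(2) by auto
    qed
    have "(\<lambda>a b. adj a b \<and> a \<in> M \<and> b \<in> M)\<^sup>*\<^sup>* x y" if "x \<in> M" "y \<in> M" for x y
      using that(1)
    proof (induction "d y x" arbitrary: x)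
      case 0
      then have "x = y" using d_zero by metis
      then show ?case by simp
    next
      case (Suc n)
      then have "y \<noteq> x" by auto
      then obtain z where z: "adj x z" "d y x = Suc (d y z)" using closer_exists by blast
      have zM: "z \<in> M" using step[OF Suc.prems that(2) z] .
      then have "(\<lambda>a b. adj a b \<and> a \<in> M \<and> b \<in> M)\<^sup>*\<^sup>* z y" using Suc z by auto
      then show ?case using z zM Suc.prems by (intro converse_rtranclp_into_rtranclp[of _ x z]) auto
    qed
    then have "subtree adj M" using v unfolding subtree_def by blast
    moreover have "g ` M \<subseteq> M" if "g \<in> G" for g
    proof
      fix y assume "y \<in> g ` M"
      then obtain x where x: "x \<in> M" "y = g x" by blast
      show "y \<in> M" unfolding M_def x(2)
      proof (intro CollectI ballI)
        fix q assume "q \<in> G"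
        then have "q \<circ> g \<in> G" using that G_comp by blast
        then show "q (g x) \<notin> A" using x(1) unfolding M_def by (metis (mono_tags, lifting) comp_apply mem_Collect_eq)
      qed
    qed
    ultimately have "M = UNIV" using minimal unfolding minimal_action_def by blast
    then have "w \<in> M" by blast
    then show False using G_id in_H[OF uw(1)] uw(2) unfolding M_def by fastforce
  qed
  then show ?thesis using that unfolding M_def by blast
qed

text \<open>Two hyperbolic elements without a common endpoint cannot both have the repelling end of
  \<open>f\<close> as an endpoint, so one of their axes stays off a half-tree around that end. A
  power of \<open>f\<close> pushes this axis forward past the edge from \<open>l 0\<close> to
  \<open>l 1\<close>.\<close>

lemma push_axis:
  assumes f: "f \<in> G" "translates adj f l k"
  obtains f' l' k' where "f' \<in> G" "translates adj f' l' k'" "range l' \<subseteq> H (l 0) (l 1)"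
proof -
  obtain g h where gh: "g \<in> G" "h \<in> G" "hyperbolic adj g" "hyperbolic adj h"
    "endpoints adj g \<inter> endpoints adj h = {}" using general unfolding general_type_def by blast
  have l: "line adj l" and k: "k > 0" using f(2) unfolding translates_def by auto
  let ?eta = "end_of adj (\<lambda>n. l (0 - int n))"
  have eta: "?eta \<in> endpoints adj e"
    if tr: "translates adj e m km" and enters: "\<And>i. range m \<inter> H (l (i + 1)) (l i) \<noteq> {}" for e m km
  proof -
    have m: "line adj m" using tr unfolding translates_def by auto
    obtain c c' where c: "(\<forall>n. m (c + int n) = l (c' - int n)) \<or> (\<forall>n. m (c - int n) = l (c' - int n))"
      using line_common_end[OF l m enters] by blast
    have "?eta = end_of adj (\<lambda>n. l (c' - int n))" by (rule line_end_indep)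
    also have "\<dots> = end_of adj (\<lambda>n. m (c + int n)) \<or> \<dots> = end_of adj (\<lambda>n. m (c - int n))"
      using c by auto
    finally show ?thesis using translates_hyperbolic_endpoint[OF tr] by metis
  qed
  obtain mg kg mh kh where t: "translates adj g mg kg" "translates adj h mh kh"
    using gh(3,4) unfolding hyperbolic_def by blast
  have "\<exists>e m km i. e \<in> G \<and> translates adj e m km \<and> range m \<inter> H (l (i + 1)) (l i) = {}"
    using eta[OF t(1)] eta[OF t(2)] t gh by blast
  then obtain e m km i where e: "e \<in> G" "translates adj e m km" "range m \<inter> H (l (i + 1)) (l i) = {}"
    by blast
  \<comment> \<open>One application of \<open>f\<close> advances by at least 1, so this many
    applications carry position \<open>i\<close> to a non-negative one.\<close>
  define N where "N = nat \<bar>i\<bar>"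
  have N: "0 \<le> i + int N * k"
  proof -
    have "int N * 1 \<le> int N * k" using k by (intro mult_left_mono) auto
    then show ?thesis unfolding N_def by linarith
  qed
  let ?q = "f ^^ N"
  have q: "?q \<in> G" using G_funpow f by blast
  have "range m \<subseteq> H (l i) (l (i + 1))" using e(3) H_compl[OF line_adj(1)[OF l]] H_compl[OF line_adj(2)[OF l]] by blast
  then have "?q ` range m \<subseteq> H (?q (l i)) (?q (l (i + 1)))" using G_H[OF q] by blast
  also have "\<dots> = H (l (i + int N * k)) (l (i + int N * k + 1))"
    using translates_funpow[OF f(2)] by (simp add: algebra_simps)
  also have "\<dots> \<subseteq> H (l 0) (l (0 + 1))" using line_H_mono(1)[OF l N] .
  finally have "range (?q \<circ> m) \<subseteq> H (l 0) (l 1)" by auto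
  moreover have "?q \<circ> e \<circ> inv ?q \<in> G" using q e G_comp G_inv by blast
  ultimately show ?thesis using that translates_conj[OF G_aut[OF q] e(2)] by blast
qed

text \<open>By minimality some conjugate axis meets \<open>A\<close>. If it is not contained in
  \<open>A\<close>, then, after passing to the inverse if necessary, it enters \<open>A\<close>
  across the bounding edge, and \<open>push_axis\<close> applies there.\<close>

lemma axis_in_halftree:
  assumes "A \<in> halftrees"
  obtains f l k where "f \<in> G" "translates adj f l k" "range l \<subseteq> A"
proof -
  note result = that
  obtain u w where uw: "adj u w" "A = H u w" using assms by (rule halftreeE)
  obtain g l0 k where g: "g \<in> G" "translates adj g l0 k"
    using general unfolding general_type_def hyperbolic_def by blast
  obtain q where q: "q \<in> G" "q (l0 0) \<in> A" using orbit_meets_halftree[OF assms] by blast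
  define f where "f = q \<circ> g \<circ> inv q"
  define l where "l = q \<circ> l0"
  have f: "f \<in> G" "translates adj f l k"
    unfolding f_def l_def using q g G_comp G_inv translates_conj[OF G_aut[OF q(1)]] by blast+
  have l0: "l 0 \<in> A" using q by (simp add: l_def)
  show ?thesis
  proof (cases "range l \<subseteq> A")
    case True
    with f that show ?thesis by blast
  next
    case False
    then obtain j where j: "l j \<notin> A" by blast
    \<comment> \<open>The first visit to \<open>A\<close> is along the edge from \<open>u\<close> to
      \<open>w\<close>; the shift by \<open>m'\<close> brings this edge to positions 0 and 1, where
      \<open>push_axis\<close> expects it.\<close>
    have main: thesis if t: "f \<in> G" "translates adj f l k" "l (int n) \<in> A" "l 0 \<notin> A" for f l and n :: nat
    proof -
      have ln: "line adj l" using t(2) by (simp add: translates_def)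
      define m where "m = (LEAST n. l (int n) \<in> A)"
      have m: "l (int m) \<in> A" unfolding m_def by (rule LeastI[of _ n]) (rule t(3))
      then have "m \<noteq> 0" using t(4) by (metis of_nat_0)
      then obtain m' where m': "m = Suc m'" using not0_implies_Suc by blast
      have "l (int m') \<notin> A" using not_less_Least[of m' "\<lambda>n. l (int n) \<in> A"] m' m_def by simp
      moreover have "l (int m' + 1) \<in> A" using m m' by (simp add: add.commute)
      ultimately have e: "l (int m') = u" "l (int m' + 1) = w"
        using H_crossing[OF uw(1) line_adj(1)[OF ln, of "int m'"]] uw(2) by auto
      let ?l = "\<lambda>i. l (i + int m')"
      have l01: "?l 0 = u" "?l 1 = w" using e by (simp_all add: add.commute)
      obtain f' l' k' where "f' \<in> G" "translates adj f' l' k'" "range l' \<subseteq> H (?l 0) (?l 1)"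
        by (rule push_axis[OF t(1) translates_shift[OF t(2), of "int m'"]])
      then show thesis using result uw(2) unfolding l01 by blast
    qed
    show ?thesis
    proof (cases "j \<le> 0")
      case True
      show ?thesis
        by (rule main[of f "\<lambda>i. l (i + j)" "nat (- j)"]) (use f translates_shift True l0 j in auto)
    next
      case False
      note tr = translates_shift[OF translates_rev[OF G_aut[OF f(1)] f(2)], of "- j"]
      show ?thesis
        by (rule main[OF G_inv[OF f(1)] tr, of "nat j"]) (use False l0 j in auto)
    qed
  qed
qed

lemma halftree_split:
  assumes "A \<in> halftrees"
  obtains B C where "B \<in> halftrees" "C \<in> halftrees" "B \<subseteq> A" "C \<subseteq> A" "B \<inter> C = {}"
proof -
  obtain u w where uw: "adj u w" "A = H u w" using assms by (rule halftreeE)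
  obtain f l k where f: "translates adj f l k" "range l \<subseteq> H u w" using axis_in_halftree[OF assms] uw by metis
  then have l: "line adj l" by (simp add: translates_def)
  obtain j where j: "H (l j) (l (j + 1)) \<subseteq> H u w" "H (l j) (l (j - 1)) \<subseteq> H u w"
      "u \<notin> H (l j) (l (j + 1))" "u \<notin> H (l j) (l (j - 1))"
    by (rule line_branch[OF uw(1) l f(2)])
  have a: "adj (l j) (l (j + 1))" "adj (l j) (l (j - 1))"
    using line_adj[OF l] line_adj(2)[OF l, of "j - 1"] by auto
  have "l (j + 1) \<noteq> l (j - 1)" using line_inj[OF l] by simp
  then have "H (l j) (l (j + 1)) \<inter> H (l j) (l (j - 1)) = {}" by (rule H_disjoint[OF a])
  then show ?thesis using that[OF halftreeI[OF a(1)] halftreeI[OF a(2)]] j uw(2) by simp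
qed

text \<open>An axis in the complement of \<open>B\<close> moves \<open>B\<close> off itself.\<close>
lemma halftree_displace:
  assumes "B \<in> halftrees" obtains y where "y \<in> G" "y ` B \<inter> B = {}"
proof -
  have "- B \<in> halftrees" using assms halftree_compl by blast
  then obtain w u where uw: "adj w u" "- B = H w u" by (rule halftreeE)
  obtain f l k where f: "f \<in> G" "translates adj f l k" "range l \<subseteq> H w u"
    using axis_in_halftree[OF \<open>- B \<in> halftrees\<close>] uw by metis
  then have l: "line adj l" and k: "k > 0" by (auto simp: translates_def)
  obtain j where j: "H (l j) (l (j + 1)) \<subseteq> H w u" "H (l j) (l (j - 1)) \<subseteq> H w u"
      "w \<notin> H (l j) (l (j + 1))" "w \<notin> H (l j) (l (j - 1))"
    by (rule line_branch[OF uw(1) l f(3)])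
  have "H (l j) (l (j - 1)) = - H (l (j - 1)) (l j)"
    using H_compl[OF line_adj(1)[OF l, of "j - 1"]] by simp
  then have "B \<subseteq> H (l (j - 1)) (l (j - 1 + 1))" using j(2) uw(2) by auto
  then have "f ` B \<subseteq> H (f (l (j - 1))) (f (l (j - 1 + 1)))" using G_H[OF f(1)] by blast
  also have "\<dots> = H (l (j - 1 + k)) (l (j - 1 + k + 1))"
    using f(2) by (simp add: translates_def algebra_simps)
  also have "\<dots> \<subseteq> H (l j) (l (j + 1))" using line_H_mono(1)[OF l, of j "j - 1 + k"] k by simp
  finally have "f ` B \<inter> B = {}" using j(1) uw(2) by blast
  with that f show ?thesis by blast
qed

lemma halftree_into:
  assumes A: "A \<in> halftrees" and B: "B \<in> halftrees"
  obtains g where "g \<in> G" "g ` B \<subseteq> A"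
proof -
  obtain u w where uw: "adj u w" "A = H u w" using A by (rule halftreeE)
  obtain f l k where f: "f \<in> G" "translates adj f l k" "range l \<subseteq> H u w"
    using axis_in_halftree[OF A] uw by metis
  then have l: "line adj l" and k: "k > 0" by (auto simp: translates_def)
  obtain j where j: "H (l j) (l (j + 1)) \<subseteq> H u w" "H (l j) (l (j - 1)) \<subseteq> H u w"
      "u \<notin> H (l j) (l (j + 1))" "u \<notin> H (l j) (l (j - 1))"
    by (rule line_branch[OF uw(1) l f(3)])
  obtain y where y: "y \<in> G" "y ` B \<inter> B = {}" using halftree_displace[OF B] by blast
  obtain u1 w1 where 1: "adj u1 w1" "B = H u1 w1" using B by (rule halftreeE)
  obtain u2 w2 where 2: "adj u2 w2" "y ` B = H u2 w2" using G_halftree[OF y(1) B] by (rule halftreeE)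
  obtain m1 where m1: "\<And>i. i \<le> m1 \<Longrightarrow> u1 \<notin> H (l (i + 1)) (l i)" using line_escape[OF l] by blast
  obtain m2 where m2: "\<And>i. i \<le> m2 \<Longrightarrow> u2 \<notin> H (l (i + 1)) (l i)" using line_escape[OF l] by blast
  \<comment> \<open>So far back that \<open>?C\<close> contains neither \<open>u1\<close> nor
    \<open>u2\<close>; then neither bounding edge cuts \<open>?C\<close>, which is thus inside or
    outside each of the two half-trees.\<close>
  define i where "i = min m1 m2"
  let ?C = "H (l (i + 1)) (l i)"
  note a = line_adj(2)[OF l, of i]
  have "?C \<subseteq> B \<or> ?C \<inter> B = {}" "?C \<subseteq> y ` B \<or> ?C \<inter> y ` B = {}"
    using H_uncut'[OF a 1(1)] H_uncut'[OF a 2(1)] m1[of i] m2[of i] 1(2) 2(2) i_def by auto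
  moreover have "?C \<noteq> {}" using in_H[OF a] by blast
  ultimately have "?C \<inter> B = {} \<or> ?C \<inter> y ` B = {}" using y(2) by blast
  then obtain x where x: "x \<in> G" "?C \<inter> x ` B = {}" using y(1) G_id by (metis image_id id_apply)
  define N where "N = nat \<bar>j - i\<bar>"
  have N: "j \<le> i + int N * k"
  proof -
    have "int N * 1 \<le> int N * k" using k by (intro mult_left_mono) auto
    then show ?thesis unfolding N_def by linarith
  qed
  let ?q = "f ^^ N"
  have q: "?q \<in> G" using G_funpow f by blast
  have "x ` B \<subseteq> H (l i) (l (i + 1))" using x(2) H_compl[OF line_adj(1)[OF l, of i]] by blast
  then have "?q ` x ` B \<subseteq> H (?q (l i)) (?q (l (i + 1)))" using G_H[OF q] by blast
  also have "\<dots> = H (l (i + int N * k)) (l (i + int N * k + 1))"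
    using translates_funpow[OF f(2)] by (simp add: algebra_simps)
  also have "\<dots> \<subseteq> H (l j) (l (j + 1))" using line_H_mono(1)[OF l N] .
  also have "\<dots> \<subseteq> A" using j uw by simp
  finally have "(?q \<circ> x) ` B \<subseteq> A" by (simp add: image_comp)
  with that q x(1) G_comp show ?thesis by blast
qed

lemma shadow_nonempty: assumes "adj z v" shows "shadow adj z v \<noteq> {}"
proof -
  obtain f l k where "f \<in> G" and f: "translates adj f l k" "range l \<subseteq> H z v"
    by (rule axis_in_halftree[OF halftreeI[OF assms]])
  have "line adj l" using f(1) by (simp add: translates_def)
  from line_ray[OF this] have r: "ray adj (\<lambda>n. l (0 + int n))" .
  have "end_of adj (\<lambda>n. l (0 + int n)) \<in> shadow adj z v"
    by (rule shadow_frequently[OF r assms]) (use f(2) in auto)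
  then show ?thesis by blast
qed

lemma fixes_halftree:
  assumes g: "g \<in> G" and uw: "adj u w" and fx: "\<And>\<xi>. \<xi> \<in> shadow adj u w \<Longrightarrow> end_act g \<xi> = \<xi>"
  obtains E where "E \<in> halftrees" "\<And>v. v \<in> E \<Longrightarrow> g v = v"
proof -
  obtain f l k where "f \<in> G" and f: "translates adj f l k" "range l \<subseteq> H u w"
    by (rule axis_in_halftree[OF halftreeI[OF uw]])
  then have l: "line adj l" by (simp add: translates_def)
  obtain j where j: "H (l j) (l (j + 1)) \<subseteq> H u w" "H (l j) (l (j - 1)) \<subseteq> H u w"
      "u \<notin> H (l j) (l (j + 1))" "u \<notin> H (l j) (l (j - 1))"
    by (rule line_branch[OF uw l f(2)])
  define v where "v = l j"
  have va: "adj v (l (j + 1))" "adj v (l (j - 1))"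
    using line_adj[OF l] line_adj(2)[OF l, of "j - 1"] unfolding v_def by auto
  have lne: "l (j - 1) \<noteq> l (j + 1)" using line_inj[OF l] by simp
  obtain f2 l2 k2 where "f2 \<in> G" and f2: "translates adj f2 l2 k2" "range l2 \<subseteq> H v (l (j + 1))"
    by (rule axis_in_halftree[OF halftreeI[OF va(1)]])
  then have l2: "line adj l2" by (simp add: translates_def)
  obtain i where i: "H (l2 i) (l2 (i + 1)) \<subseteq> H v (l (j + 1))" "H (l2 i) (l2 (i - 1)) \<subseteq> H v (l (j + 1))"
    "v \<notin> H (l2 i) (l2 (i + 1))" "v \<notin> H (l2 i) (l2 (i - 1))"
    by (rule line_branch[OF va(1) l2 f2(2)])
  define p where "p = l2 i"
  have pa: "adj p (l2 (i + 1))" "adj p (l2 (i - 1))"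
    using line_adj[OF l2] line_adj(2)[OF l2, of "i - 1"] unfolding p_def by auto
  have pv: "p \<in> H v (l (j + 1))" using f2(2) p_def by blast
  then have "v \<noteq> p" using notin_H by blast
  then obtain x3 where x3: "adj p x3" "d v p = Suc (d v x3)" using closer_exists by blast
  have v3: "v \<in> H p x3" using x3 mem_H by blast
  obtain \<xi>1 where s1: "\<xi>1 \<in> shadow adj p (l2 (i + 1))" using shadow_nonempty[OF pa(1)] by blast
  obtain \<xi>2 where s2: "\<xi>2 \<in> shadow adj p (l2 (i - 1))" using shadow_nonempty[OF pa(2)] by blast
  obtain \<xi>3 where s3: "\<xi>3 \<in> shadow adj v (l (j - 1))" using shadow_nonempty[OF va(2)] by blast
  have s3': "\<xi>3 \<in> shadow adj p x3" using shadow_turn[OF va(1) pv x3 va(2) lne s3] .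
  have sub: "H p (l2 (i + 1)) \<subseteq> H u w" "H p (l2 (i - 1)) \<subseteq> H u w" "H v (l (j - 1)) \<subseteq> H u w"
    using i(1,2) j(1,2) unfolding p_def v_def by blast+
  have fx': "end_act g \<xi>1 = \<xi>1" "end_act g \<xi>2 = \<xi>2" "end_act g \<xi>3 = \<xi>3"
    using fx shadow_mono[OF uw sub(1)] shadow_mono[OF uw sub(2)] shadow_mono[OF uw sub(3)] s1 s2 s3
    by blast+
  have ne: "l2 (i + 1) \<noteq> l2 (i - 1)" "l2 (i + 1) \<noteq> x3" "l2 (i - 1) \<noteq> x3"
    using line_inj[OF l2] i(3,4) v3 unfolding p_def by auto
  have gp: "g p = p"
    using fixed_median[OF G_aut[OF g] pa x3(1) ne s1 s2 s3' fx'] .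
  have "g x = x" if "x \<in> H p (l2 (i + 1))" for x
    by (rule fixed_halftree[OF G_aut[OF g] uw pa(1) sub(1) gp notin_H fx shadow_nonempty that])
  then show ?thesis using that halftreeI[OF pa(1)] by blast
qed

section \<open>Rigid stabilizers of half-trees\<close>

definition rigid :: "'v set \<Rightarrow> ('v \<Rightarrow> 'v) set" where
  "rigid A = {g \<in> G. \<forall>v. v \<notin> A \<longrightarrow> g v = v}"

text \<open>Non-freeness yields a non-trivial element fixing some half-tree pointwise, so it is
  supported in the complementary half-tree; a conjugation brings that support into
  \<open>A\<close>.\<close>

lemma rigid_exists:
  assumes "\<not> topologically_free adj G" "A \<in> halftrees"
  obtains g where "g \<in> rigid A" "g \<noteq> id"
proof -
  obtain g where g: "g \<in> G" "g \<noteq> id" "boundary_topology adj interior_of end_fix adj g \<noteq> {}"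
    using assms(1) unfolding topologically_free_def by blast
  then obtain U \<xi> where U: "openin (boundary_topology adj) U" "\<xi> \<in> U" "U \<subseteq> end_fix adj g"
    unfolding interior_of_def by blast
  obtain u w where uw: "adj u w" "shadow adj u w \<subseteq> U" using boundary_basis[OF U(1,2)] by blast
  have "end_act g \<xi> = \<xi>" if "\<xi> \<in> shadow adj u w" for \<xi>
    using that uw U(3) unfolding end_fix_def by blast
  from fixes_halftree[OF g(1) uw(1) this] obtain E where E: "E \<in> halftrees" "\<And>v. v \<in> E \<Longrightarrow> g v = v"
    by blast
  obtain k where k: "k \<in> G" "k ` (- E) \<subseteq> A" using halftree_into[OF assms(2) halftree_compl[OF E(1)]] by blast
  have kb: "bij k" using G_bij k by blast
  let ?g = "k \<circ> g \<circ> inv k"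
  have "?g v = v" if "v \<notin> A" for v
  proof -
    have ki: "k (inv k v) = v" using bij_is_surj[OF kb] by (rule surj_f_inv_f)
    have "inv k v \<in> E"
    proof (rule ccontr)
      assume "inv k v \<notin> E"
      then have "k (inv k v) \<in> k ` (- E)" by blast
      then show False using k(2) ki that by auto
    qed
    from E(2)[OF this] show ?thesis using ki by simp
  qed
  moreover have "?g \<in> G" by (rule G_comp[OF G_comp[OF k(1) g(1)] G_inv[OF k(1)]])
  moreover have "?g \<noteq> id"
  proof
    assume "?g = id"
    have "k (g x) = k x" for x
      using fun_cong[OF \<open>?g = id\<close>, of "k x"] inv_f_f[OF bij_is_inj[OF kb]] by simp
    then have "g = id" using injD[OF bij_is_inj[OF kb]] by (intro ext) simp
    then show False using g by simp
  qed
  ultimately show ?thesis using that[of ?g] unfolding rigid_def by simp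
qed

text \<open>Rules out a constant equivariant map to the boundary. An element that displaces the
  half-tree behind the first edge of a ray moves its end.\<close>

lemma no_fixed_end:
  assumes "\<xi> \<in> ends adj" obtains g where "g \<in> G" "end_act g \<xi> \<noteq> \<xi>"
proof -
  obtain r where r: "ray adj r" "\<xi> = end_of adj r" using assms by (rule ends_ray)
  have a: "adj (r 0) (r 1)" using r(1) by (metis One_nat_def ray_def)
  let ?B = "H (r 0) (r 1)"
  have B: "?B \<in> halftrees" using halftreeI[OF a] .
  obtain g where g: "g \<in> G" "g ` ?B \<inter> ?B = {}" using halftree_displace[OF B] by blast
  have "end_act g \<xi> \<noteq> \<xi>"
  proof
    assume "end_act g \<xi> = \<xi>"
    then have "end_of adj (g \<circ> r) = end_of adj r" using end_act_end_of[OF G_aut[OF g(1)]] r by simp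
    then have "g \<circ> r \<in> end_of adj r" using ray_end_of[OF ray_aut[OF G_aut[OF g(1)] r(1)]] by simp
    then obtain a b where ab: "\<And>n. (g \<circ> r) (n + a) = r (n + b)" using end_of_tails by blast
    have "r (1 + a) \<in> ?B" "r (1 + b) \<in> ?B" using ray_in_H[OF r(1)] by auto
    then show False using ab[of 1] g(2) by fastforce
  qed
  with that g show ?thesis by blast
qed

text \<open>One of two disjoint half-trees inside \<open>H u w\<close> misses \<open>w\<close>; its
  own gate is then strictly farther from \<open>A\<close> than \<open>w\<close>.\<close>

lemma far_halftree:
  assumes "A \<in> halftrees"
  shows "\<exists>u w. adj u w \<and> H u w \<inter> A = {} \<and> (\<forall>x\<in>A. n \<le> d x w)"
proof (induction n)
  case 0
  obtain u w where "adj u w" "- A = H u w" using halftree_compl[OF assms] by (rule halftreeE)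
  then show ?case by (intro exI[of _ u] exI[of _ w]) auto
next
  case (Suc n)
  then obtain u w where uw: "adj u w" "H u w \<inter> A = {}" "\<forall>x\<in>A. n \<le> d x w" by blast
  obtain B C where BC: "B \<in> halftrees" "C \<in> halftrees" "B \<subseteq> H u w" "C \<subseteq> H u w" "B \<inter> C = {}"
    by (rule halftree_split[OF halftreeI[OF uw(1)]])
  then obtain E where E: "E \<in> halftrees" "E \<subseteq> H u w" "w \<notin> E" by blast
  then obtain a b where ab: "adj a b" "E = H a b" by (meson halftreeE)
  have b: "b \<in> H u w" "b \<noteq> w" using in_H[OF ab(1)] ab(2) E by auto
  have "Suc n \<le> d x b" if "x \<in> A" for x
  proof -
    have "x \<notin> H u w" using that uw(2) by blast
    from H_gate(2)[OF uw(1) this b] uw(3) that show ?thesis by fastforce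
  qed
  then show ?case using ab E(2) uw(2) by blast
qed

lemma halftree_far_translate:
  assumes "A \<in> halftrees"
  obtains g where "g \<in> G" "\<And>x y. x \<in> A \<Longrightarrow> y \<in> g ` A \<Longrightarrow> n < d x y"
proof -
  obtain u w where uw: "adj u w" "H u w \<inter> A = {}" "\<forall>x\<in>A. Suc n \<le> d x w"
    using far_halftree[OF assms] by blast
  obtain g where g: "g \<in> G" "g ` A \<subseteq> H u w" by (rule halftree_into[OF halftreeI[OF uw(1)] assms])
  have "n < d x y" if "x \<in> A" "y \<in> g ` A" for x y
  proof -
    have "x \<notin> H u w" "y \<in> H u w" using that uw(2) g(2) by auto
    from H_gate(1)[OF uw(1) this] uw(3) that(1) show ?thesis by fastforce
  qed
  with that g show ?thesis by blast
qed

lemma rigid_G: "a \<in> rigid A \<Longrightarrow> a \<in> G"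
  and rigid_fix: "a \<in> rigid A \<Longrightarrow> v \<notin> A \<Longrightarrow> a v = v"
  unfolding rigid_def by auto

lemma rigid_mono: "a \<in> rigid A \<Longrightarrow> A \<subseteq> B \<Longrightarrow> a \<in> rigid B"
  unfolding rigid_def by auto

lemma rigid_eq_iff: "a \<in> rigid A \<Longrightarrow> a x = a y \<longleftrightarrow> x = y"
  using aut_inj[OF G_aut[OF rigid_G]] .

lemma rigid_image: assumes "a \<in> rigid A" "v \<in> A" shows "a v \<in> A"
proof (rule ccontr)
  assume n: "a v \<notin> A"
  then have "a (a v) = a v" by (rule rigid_fix[OF assms(1)])
  then have "a v = v" using rigid_eq_iff[OF assms(1)] by blast
  then show False using n assms(2) by simp
qed

lemma rigid_comp: "a \<in> rigid A \<Longrightarrow> b \<in> rigid A \<Longrightarrow> a \<circ> b \<in> rigid A"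
  unfolding rigid_def using G_comp[of a b] by simp

lemma inv_apply: "g \<in> G \<Longrightarrow> inv g (g v) = v" "g \<in> G \<Longrightarrow> g (inv g v) = v"
  by (rule inv_f_f[OF bij_is_inj[OF G_bij]] surj_f_inv_f[OF bij_is_surj[OF G_bij]], assumption)+

lemma rigid_inv: assumes "a \<in> rigid A" shows "inv a \<in> rigid A"
proof -
  note aG = rigid_G[OF assms]
  have "inv a v = v" if "v \<notin> A" for v
    using inv_apply(1)[OF aG, of v] rigid_fix[OF assms that] by simp
  with G_inv[OF aG] show ?thesis unfolding rigid_def by blast
qed

lemma rigid_commute:
  assumes "a \<in> rigid A" "b \<in> rigid B" "A \<inter> B = {}" shows "a \<circ> b = b \<circ> a"
proof
  fix v
  consider "v \<in> A" | "v \<in> B" | "v \<notin> A" "v \<notin> B" by blast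
  then show "(a \<circ> b) v = (b \<circ> a) v"
  proof cases
    case 1
    then have "v \<notin> B" "a v \<notin> B" using rigid_image[OF assms(1)] assms(3) by auto
    then show ?thesis using rigid_fix[OF assms(2)] by simp
  next
    case 2
    then have "v \<notin> A" "b v \<notin> A" using rigid_image[OF assms(2)] assms(3) by auto
    then show ?thesis using rigid_fix[OF assms(1)] by simp
  next
    case 3
    then show ?thesis using rigid_fix[OF assms(1)] rigid_fix[OF assms(2)] by simp
  qed
qed

lemma rigid_disjoint_eq:
  assumes "a \<in> rigid A" "a \<in> rigid B" "A \<inter> B = {}" shows "a = id"
proof
  fix v show "a v = id v"
    using assms(3) rigid_fix[OF assms(1), of v] rigid_fix[OF assms(2), of v] by auto
qed

lemma image_disjoint: "g \<in> G \<Longrightarrow> A \<inter> B = {} \<Longrightarrow> g ` A \<inter> g ` B = {}"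
  using image_Int[OF bij_is_inj[OF G_bij], of g A B] by simp

definition conj_by :: "('v \<Rightarrow> 'v) \<Rightarrow> ('v \<Rightarrow> 'v) \<Rightarrow> 'v \<Rightarrow> 'v" where
  "conj_by g a = g \<circ> a \<circ> inv g"

lemma conj_by_G: "g \<in> G \<Longrightarrow> a \<in> G \<Longrightarrow> conj_by g a \<in> G"
  unfolding conj_by_def by (rule G_comp[OF G_comp G_inv])

lemma conj_by_comp: "g \<in> G \<Longrightarrow> conj_by g a \<circ> g = g \<circ> a"
  unfolding conj_by_def using inv_apply(1) by (auto simp: fun_eq_iff)

lemma conj_by_neq_id: assumes "g \<in> G" "a \<noteq> id" shows "conj_by g a \<noteq> id"
proof
  assume c: "conj_by g a = id"
  have "g (a v) = g v" for v using fun_cong[OF conj_by_comp[OF assms(1), of a], of v] c by simp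
  then have "a = id" using aut_inj[OF G_aut[OF assms(1)]] by (auto simp: fun_eq_iff)
  then show False using assms(2) by simp
qed

lemma rigid_conj_by: assumes "a \<in> rigid A" "g \<in> G" shows "conj_by g a \<in> rigid (g ` A)"
proof -
  have "conj_by g a v = v" if "v \<notin> g ` A" for v
  proof -
    have "inv g v \<notin> A" using that inv_apply(2)[OF assms(2), of v] by (metis imageI)
    then show ?thesis using rigid_fix[OF assms(1)] inv_apply(2)[OF assms(2)] by (simp add: conj_by_def)
  qed
  then show ?thesis using conj_by_G[OF assms(2) rigid_G[OF assms(1)]] unfolding rigid_def by blast
qed

lemma displaced_by_rigid:
  assumes "A \<in> halftrees" "a \<in> rigid A" "a \<noteq> id"
  obtains E where "E \<in> halftrees" "E \<subseteq> A" "a ` E \<inter> E = {}"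
  using displaced_halftree[OF G_aut[OF rigid_G[OF assms(2)]] assms(1) _ assms(3)]
    rigid_fix[OF assms(2)] by blast

lemma halftree_split4:
  assumes "A \<in> halftrees"
  obtains B1 B2 B3 B4 where "B1 \<in> halftrees" "B2 \<in> halftrees" "B3 \<in> halftrees" "B4 \<in> halftrees"
    "B1 \<inter> B2 = {}" "B1 \<inter> B3 = {}" "B1 \<inter> B4 = {}" "B2 \<inter> B3 = {}" "B2 \<inter> B4 = {}" "B3 \<inter> B4 = {}"
proof -
  obtain B C where BC: "B \<in> halftrees" "C \<in> halftrees" "B \<subseteq> A" "C \<subseteq> A" "B \<inter> C = {}"
    by (rule halftree_split[OF assms])
  obtain B1 B2 where B: "B1 \<in> halftrees" "B2 \<in> halftrees" "B1 \<subseteq> B" "B2 \<subseteq> B" "B1 \<inter> B2 = {}"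
    by (rule halftree_split[OF BC(1)])
  obtain C1 C2 where C: "C1 \<in> halftrees" "C2 \<in> halftrees" "C1 \<subseteq> C" "C2 \<subseteq> C" "C1 \<inter> C2 = {}"
    by (rule halftree_split[OF BC(2)])
  show ?thesis
    by (rule that[OF B(1,2) C(1,2) B(5) _ _ _ _ C(5)]) (use B C BC(5) in blast)+
qed

end

section \<open>Triply transitive actions\<close>

locale tree_action = tree_group adj G
  for adj :: "'v \<Rightarrow> 'v \<Rightarrow> bool" and G :: "('v \<Rightarrow> 'v) set" +
  fixes \<Omega> :: "'w set" and act :: "('v \<Rightarrow> 'v) \<Rightarrow> 'w \<Rightarrow> 'w"
  assumes action: "is_action (\<circ>) id G \<Omega> act"
    and faithful: "faithful_action id G \<Omega> act"
    and three: "three_transitive G \<Omega> act"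
begin

lemma act_closed: "g \<in> G \<Longrightarrow> x \<in> \<Omega> \<Longrightarrow> act g x \<in> \<Omega>"
  and act_id: "x \<in> \<Omega> \<Longrightarrow> act id x = x"
  and act_comp: "g \<in> G \<Longrightarrow> h \<in> G \<Longrightarrow> x \<in> \<Omega> \<Longrightarrow> act (g \<circ> h) x = act g (act h x)"
  using action unfolding is_action_def by auto

lemma inv_comp: "g \<in> G \<Longrightarrow> inv g \<circ> g = id" "g \<in> G \<Longrightarrow> g \<circ> inv g = id"
  using G_bij by (auto simp: bij_is_inj bij_is_surj surj_iff[symmetric])

lemma act_inv: "g \<in> G \<Longrightarrow> x \<in> \<Omega> \<Longrightarrow> act (inv g) (act g x) = x"
  "g \<in> G \<Longrightarrow> x \<in> \<Omega> \<Longrightarrow> act g (act (inv g) x) = x"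
  using act_comp[of "inv g" g x] act_comp[of g "inv g" x] G_inv[of g] act_id[of x] inv_comp[of g]
  by simp_all

lemma act_eq_iff: "g \<in> G \<Longrightarrow> x \<in> \<Omega> \<Longrightarrow> y \<in> \<Omega> \<Longrightarrow> act g x = act g y \<longleftrightarrow> x = y"
  by (metis act_inv(1))

lemma moves: assumes "g \<in> G" "g \<noteq> id" obtains x where "x \<in> \<Omega>" "act g x \<noteq> x"
  using faithful assms unfolding faithful_action_def by blast

lemma transitive3:
  assumes "a \<in> \<Omega>" "b \<in> \<Omega>" "c \<in> \<Omega>" "a' \<in> \<Omega>" "b' \<in> \<Omega>" "c' \<in> \<Omega>"
    and "a \<noteq> b" "a \<noteq> c" "b \<noteq> c" "a' \<noteq> b'" "a' \<noteq> c'" "b' \<noteq> c'"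
  obtains g where "g \<in> G" "act g a = a'" "act g b = b'" "act g c = c'"
proof -
  have "distinct [a, b, c]" "distinct [a', b', c']" using assms by auto
  then have "\<exists>g\<in>G. act g a = a' \<and> act g b = b' \<and> act g c = c'"
    using three assms(1-6) unfolding three_transitive_def by simp
  then show ?thesis using that by blast
qed

text \<open>Being 3-transitive says nothing about a set with fewer than three points. The square of
  a hyperbolic \<open>g\<close> is non-trivial, so by faithfulness some \<open>x\<close> has three
  distinct points \<open>x\<close>, \<open>act g x\<close>, \<open>act g (act g x)\<close>.\<close>

lemma third_point: obtains c where "c \<in> \<Omega>" "c \<noteq> a" "c \<noteq> b"
proof -
  obtain g l k where g: "g \<in> G" "translates adj g l k"
    using general unfolding general_type_def hyperbolic_def by blast
  have "(g \<circ> g) (l 0) \<noteq> l 0"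
  proof -
    have "(g \<circ> g) (l 0) = l (k + k)" using g(2) by (simp add: translates_def)
    moreover have "line adj l" "k > 0" using g(2) by (auto simp: translates_def)
    ultimately show ?thesis using line_inj[of l "k + k" 0] by auto
  qed
  then have "g \<circ> g \<noteq> id" by (metis id_apply)
  then obtain x where x: "x \<in> \<Omega>" "act (g \<circ> g) x \<noteq> x" by (rule moves[OF G_comp[OF g(1) g(1)]])
  then have "act g (act g x) \<noteq> x" using act_comp g(1) by metis
  then have "act g x \<noteq> x" "act g x \<in> \<Omega>" "act g (act g x) \<in> \<Omega>" "act g (act g x) \<noteq> act g x"
    using x(1) g(1) act_closed act_eq_iff by auto
  note pts = this
  have "\<not> \<Omega> \<subseteq> {a, b}"
  proof
    assume "\<Omega> \<subseteq> {a, b}"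
    then have "x \<in> {a, b}" "act g x \<in> {a, b}" "act g (act g x) \<in> {a, b}" using x(1) pts by auto
    then show False using pts \<open>act g (act g x) \<noteq> x\<close> by auto
  qed
  then show ?thesis using that by blast
qed

lemma transitive2:
  assumes "a \<in> \<Omega>" "b \<in> \<Omega>" "a' \<in> \<Omega>" "b' \<in> \<Omega>" "a \<noteq> b" "a' \<noteq> b'"
  obtains g where "g \<in> G" "act g a = a'" "act g b = b'"
proof -
  obtain c where c: "c \<in> \<Omega>" "c \<noteq> a" "c \<noteq> b" by (rule third_point)
  obtain c' where c': "c' \<in> \<Omega>" "c' \<noteq> a'" "c' \<noteq> b'" by (rule third_point)
  show ?thesis
    by (rule transitive3[of a b c a' b' c']) (use assms c c' that in auto)
qed

lemma transitive1:
  assumes "a \<in> \<Omega>" "a' \<in> \<Omega>" obtains g where "g \<in> G" "act g a = a'"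
proof -
  obtain b where b: "b \<in> \<Omega>" "b \<noteq> a" by (rule third_point[of a a])
  obtain b' where b': "b' \<in> \<Omega>" "b' \<noteq> a'" by (rule third_point[of a' a'])
  show ?thesis by (rule transitive2[of a b a' b']) (use assms b b' that in auto)
qed

section \<open>From families of half-trees to ends\<close>

text \<open>If two points shared an end, 2-transitivity would make the map constant, and its value
  would be an end fixed by the whole group.\<close>

lemma conjugate_of_equivariant:
  assumes ends: "\<And>x. x \<in> \<Omega> \<Longrightarrow> \<xi> x \<in> ends adj"
    and equiv: "\<And>g x. g \<in> G \<Longrightarrow> x \<in> \<Omega> \<Longrightarrow> \<xi> (act g x) = end_act g (\<xi> x)"
  shows "\<exists>\<xi>\<in>ends adj. conjugate_actions G \<Omega> act (end_orbit G \<xi>) end_act"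
proof -
  obtain x0 where x0: "x0 \<in> \<Omega>" by (rule third_point)
  have "x = y" if xy: "x \<in> \<Omega>" "y \<in> \<Omega>" "\<xi> x = \<xi> y" for x y
  proof (rule ccontr)
    assume ne: "x \<noteq> y"
    have all: "\<xi> a = \<xi> b" if ab: "a \<in> \<Omega>" "b \<in> \<Omega>" for a b
    proof (cases "a = b")
      case False
      obtain g where g: "g \<in> G" "act g x = a" "act g y = b"
        by (rule transitive2[OF xy(1,2) ab ne False])
      show ?thesis using equiv[OF g(1) xy(1)] equiv[OF g(1) xy(2)] xy(3) g by simp
    qed simp
    obtain g where g: "g \<in> G" "end_act g (\<xi> x0) \<noteq> \<xi> x0" by (rule no_fixed_end[OF ends[OF x0]])
    show False using equiv[OF g(1) x0] all[OF act_closed[OF g(1) x0] x0] g(2) by simp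
  qed
  then have "inj_on \<xi> \<Omega>" by (rule inj_onI)
  moreover have "\<xi> ` \<Omega> = end_orbit G (\<xi> x0)"
  proof
    show "\<xi> ` \<Omega> \<subseteq> end_orbit G (\<xi> x0)"
    proof
      fix e assume "e \<in> \<xi> ` \<Omega>"
      then obtain y where y: "y \<in> \<Omega>" "e = \<xi> y" by blast
      obtain g where g: "g \<in> G" "act g x0 = y" by (rule transitive1[OF x0 y(1)])
      then show "e \<in> end_orbit G (\<xi> x0)" using equiv[OF g(1) x0] y unfolding end_orbit_def by blast
    qed
    show "end_orbit G (\<xi> x0) \<subseteq> \<xi> ` \<Omega>"
      unfolding end_orbit_def using equiv[OF _ x0, symmetric] act_closed[OF _ x0] by auto
  qed
  ultimately have "bij_betw \<xi> \<Omega> (end_orbit G (\<xi> x0))" by (rule bij_betw_imageI)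
  then show ?thesis using equiv ends[OF x0] unfolding conjugate_actions_def by blast
qed

text \<open>The half-trees assigned to a point shrink to an end. Otherwise they all contain some vertex,
  and by 2-transitivity the vertices obtained for distinct points would be at bounded distance.\<close>
lemma conjugate_of_family:
  assumes ht: "\<And>x. x \<in> \<Omega> \<Longrightarrow> S x \<subseteq> halftrees"
    and up: "\<And>x A B. x \<in> \<Omega> \<Longrightarrow> A \<in> S x \<Longrightarrow> B \<in> halftrees \<Longrightarrow> A \<subseteq> B \<Longrightarrow> B \<in> S x"
    and equiv: "\<And>g x A. g \<in> G \<Longrightarrow> x \<in> \<Omega> \<Longrightarrow> A \<in> S x \<Longrightarrow> g ` A \<in> S (act g x)"
    and ne: "x0 \<in> \<Omega>" "S x0 \<noteq> {}"
    and inter: "\<And>x A B. x \<in> \<Omega> \<Longrightarrow> A \<in> S x \<Longrightarrow> B \<in> S x \<Longrightarrow> A \<inter> B \<noteq> {}"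
  shows "\<exists>\<xi>\<in>ends adj. conjugate_actions G \<Omega> act (end_orbit G \<xi>) end_act"
proof -
  have core: "g z \<in> A" if "g \<in> G" "x \<in> \<Omega>" "\<And>A. A \<in> S x \<Longrightarrow> z \<in> A" "A \<in> S (act g x)" for g x z A
  proof -
    have "inv g ` A \<in> S x"
      using equiv[OF G_inv[OF that(1)] act_closed[OF that(1,2)] that(4)] act_inv(1)[OF that(1,2)] by simp
    from that(3)[OF this] show ?thesis using G_bij[OF that(1)] by (metis bij_inv_eq_iff imageE)
  qed
  have empty: "\<exists>A\<in>S x. z \<notin> A" if x: "x \<in> \<Omega>" for x z
  proof (rule ccontr)
    assume "\<not> (\<exists>A\<in>S x. z \<notin> A)"
    then have z: "\<And>A. A \<in> S x \<Longrightarrow> z \<in> A" by blast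
    obtain h0 where h0: "h0 \<in> G" "act h0 x0 = x" by (rule transitive1[OF ne(1) x])
    obtain A where A: "A \<in> S x" using ne(2) equiv[OF h0(1) ne(1)] h0(2) by blast
    obtain y where y: "y \<in> \<Omega>" "y \<noteq> x" by (rule third_point[of x x])
    obtain h where h: "h \<in> G" "act h x = y" by (rule transitive1[OF x y(1)])
    obtain g where g: "g \<in> G" "\<And>a b. a \<in> A \<Longrightarrow> b \<in> g ` A \<Longrightarrow> d z (h z) < d a b"
      by (rule halftree_far_translate[of A "d z (h z)"]) (use ht[OF x] A in auto)
    have gA: "g ` A \<in> S (act g x)" using equiv[OF g(1) x A] .
    have gx: "x \<noteq> act g x"
    proof
      assume "x = act g x"
      then obtain a where "a \<in> A \<inter> g ` A" using inter[OF x A] gA by fastforce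
      then show False using g(2)[of a a] by auto
    qed
    obtain k where k: "k \<in> G" "act k x = x" "act k y = act g x"
      by (rule transitive2[OF x y(1) x act_closed[OF g(1) x] y(2)[symmetric] gx])
    have "k z \<in> A" by (rule core[OF k(1) x z]) (use k A in auto)
    moreover have "(k \<circ> h) z \<in> g ` A"
      by (rule core[OF G_comp[OF k(1) h(1)] x z]) (use act_comp[OF k(1) h(1) x] h k gA in auto)
    ultimately have "d z (h z) < d (k z) (k (h z))" using g(2) by simp
    then show False using d_aut[OF G_aut[OF k(1)]] by simp
  qed
  \<comment> \<open>Every vertex gets an arrow to one neighbour. Upward closure yields an arrow,
    since some member misses \<open>v\<close>; intersection forbids two, since half-trees behind
    distinct neighbours are disjoint.\<close>
  have toward: "\<exists>!w. adj v w \<and> H v w \<in> S x" if x: "x \<in> \<Omega>" for x v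
  proof -
    obtain A where A: "A \<in> S x" "v \<notin> A" using empty[OF x] by blast
    obtain a b where ab: "adj a b" "A = H a b" by (rule halftreeE[of A]) (use A ht[OF x] in auto)
    have b: "b \<in> A" using in_H[OF ab(1)] ab(2) by simp
    then have "b \<noteq> v" using A(2) by blast
    then obtain z where z: "adj v z" "d b v = Suc (d b z)" using closer_exists by blast
    have "b \<in> H v z" using mem_H[OF z(1)] z(2) by simp
    then have "A \<subseteq> H v z" using H_uncut'[OF ab(1) z(1)] A(2) b ab(2) by blast
    then have zS: "H v z \<in> S x" using up[OF x A(1) halftreeI[OF z(1)]] by blast
    show ?thesis
    proof (rule ex1I[of _ z])
      show "adj v z \<and> H v z \<in> S x" using z zS by blast
      fix w assume w: "adj v w \<and> H v w \<in> S x"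
      show "w = z"
      proof (rule ccontr)
        assume "w \<noteq> z"
        from H_disjoint[OF _ z(1) this] w inter[OF x _ zS] show False by blast
      qed
    qed
  qed
  define nxt where "nxt x v = (THE w. adj v w \<and> H v w \<in> S x)" for x v
  have nxt: "adj v (nxt x v)" "H v (nxt x v) \<in> S x" if "x \<in> \<Omega>" for x v
    using theI'[OF toward[OF that, of v]] unfolding nxt_def by blast+
  have nxt_eq: "nxt x v = w" if "x \<in> \<Omega>" "adj v w" "H v w \<in> S x" for x v w
    unfolding nxt_def by (rule the1_equality[OF toward[OF that(1)]]) (intro conjI that(2,3))
  have nonback: "nxt x (nxt x v) \<noteq> v" if x: "x \<in> \<Omega>" for x v
  proof
    assume e: "nxt x (nxt x v) = v"
    have "H (nxt x v) v \<in> S x" using nxt(2)[OF x, of "nxt x v"] e by simp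
    with inter[OF x nxt(2)[OF x]] have "H v (nxt x v) \<inter> H (nxt x v) v \<noteq> {}" by blast
    then show False using H_compl[OF nxt(1)[OF x]] by blast
  qed
  define r where "r x v n = (nxt x ^^ n) v" for x v n
  have ray: "ray adj (r x v)" if "x \<in> \<Omega>" for x v
    unfolding ray_def r_def using nxt(1)[OF that] nonback[OF that] by (auto simp: eq_commute)
  have step: "end_of adj (r x v) = end_of adj (r x v')" if x: "x \<in> \<Omega>" and "adj v v'" for x v v'
  proof -
    \<comment> \<open>If no arrow ran along the edge, the arrows at its two vertices would point to
      disjoint half-trees.\<close>
    have "nxt x v = v' \<or> nxt x v' = v"
    proof (rule ccontr)
      assume c: "\<not> ?thesis"
      have "H v (nxt x v) \<subseteq> H v' v"
        by (rule H_step[OF adj_sym[OF that(2)] nxt(1)[OF x]]) (use c in auto)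
      moreover have "H v' v \<inter> H v' (nxt x v') = {}"
        by (rule H_disjoint[OF adj_sym[OF that(2)] nxt(1)[OF x]]) (use c in auto)
      ultimately show False using inter[OF x nxt(2)[OF x] nxt(2)[OF x], of v v'] by blast
    qed
    then show ?thesis
    proof
      assume "nxt x v = v'"
      then have "r x v (n + 1) = r x v' (n + 0)" for n by (simp add: r_def funpow_swap1)
      then show ?thesis by (rule end_of_eqI)
    next
      assume "nxt x v' = v"
      then have "r x v (n + 0) = r x v' (n + 1)" for n by (simp add: r_def funpow_swap1)
      then show ?thesis by (rule end_of_eqI)
    qed
  qed
  have indep: "end_of adj (r x v) = end_of adj (r x v')" if x: "x \<in> \<Omega>" for x v v'
    using connected[of v v'] by (induction rule: rtranclp_induct) (auto dest: step[OF x])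
  \<comment> \<open>\<open>undefined\<close> is just some base vertex; by \<open>indep\<close> the
    end does not depend on it.\<close>
  define \<xi> where "\<xi> x = end_of adj (r x undefined)" for x
  show ?thesis
  proof (rule conjugate_of_equivariant)
    show "\<xi> x \<in> ends adj" if "x \<in> \<Omega>" for x
      unfolding \<xi>_def by (rule end_of_ends[OF ray[OF that]])
    fix g x assume g: "g \<in> G" and x: "x \<in> \<Omega>"
    note gx = act_closed[OF g x]
    have comm: "nxt (act g x) (g v) = g (nxt x v)" for v
    proof (rule nxt_eq[OF gx])
      show "adj (g v) (g (nxt x v))" using nxt(1)[OF x] aut_adj[OF G_aut[OF g]] by simp
      show "H (g v) (g (nxt x v)) \<in> S (act g x)"
        using equiv[OF g x nxt(2)[OF x]] G_H[OF g] by simp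
    qed
    have "g (r x v n) = r (act g x) (g v) n" for v n
      unfolding r_def by (induction n) (simp_all add: comm[symmetric])
    then have "g \<circ> r x undefined = r (act g x) (g undefined)" by (intro ext) simp
    then show "\<xi> (act g x) = end_act g (\<xi> x)"
      unfolding \<xi>_def end_act_end_of[OF G_aut[OF g]] using indep[OF gx] by simp
  qed
qed

section \<open>Common fixed points against common moved points\<close>

lemma act_commute:
  assumes "a \<in> rigid A" "b \<in> rigid B" "A \<inter> B = {}" "x \<in> \<Omega>"
  shows "act a (act b x) = act b (act a x)"
  using rigid_commute[OF assms(1-3)] act_comp[OF rigid_G[OF assms(1)] rigid_G[OF assms(2)] assms(4)]
    act_comp[OF rigid_G[OF assms(2)] rigid_G[OF assms(1)] assms(4)] by simp

lemma act_conj_by: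
  assumes "g \<in> G" "a \<in> G" "x \<in> \<Omega>" shows "act (conj_by g a) (act g x) = act g (act a x)"
  using act_comp[OF conj_by_G[OF assms(1,2)] assms(1,3)] act_comp[OF assms] conj_by_comp[OF assms(1), of a]
  by simp

text \<open>Both \<open>q1\<close> and \<open>q2\<close> are moved by both elements. Let
  \<open>g\<close> send \<open>p\<close> to \<open>r\<close> and fix \<open>q1\<close> and
  \<open>q2\<close>. Then the conjugates of \<open>a\<close> and \<open>b\<close> by
  \<open>g\<close> send \<open>r\<close> to \<open>q1\<close> and \<open>q2\<close>. One of these
  conjugates commutes with \<open>a\<close> or with \<open>b\<close>, which fixes \<open>r\<close>
  and would therefore fix \<open>q1\<close> or \<open>q2\<close>.\<close>

lemma common_fixed_no_common_moved:
  assumes AB: "A \<in> halftrees" "B \<in> halftrees" "A \<inter> B = {}"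
    and ab: "a \<in> rigid A" "b \<in> rigid B"
    and r: "r \<in> \<Omega>" "act a r = r" "act b r = r"
    and p: "p \<in> \<Omega>" "act a p \<noteq> p" "act b p \<noteq> p"
  shows False
proof -
  note aG = rigid_G[OF ab(1)] and bG = rigid_G[OF ab(2)]
  define q1 where "q1 = act a p"
  define q2 where "q2 = act b p"
  have q: "q1 \<in> \<Omega>" "q2 \<in> \<Omega>" using act_closed aG bG p(1) unfolding q1_def q2_def by auto
  have mq1: "act a q1 \<noteq> q1"
    using act_eq_iff[OF aG q(1) p(1)] p(2) unfolding q1_def by simp
  have mq2: "act b q2 \<noteq> q2"
    using act_eq_iff[OF bG q(2) p(1)] p(3) unfolding q2_def by simp
  have mq3: "act b q1 \<noteq> q1"
    using act_commute[OF ab AB(3) p(1)] act_eq_iff[OF aG q(2) p(1)] p(3) unfolding q1_def q2_def by simp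
  have mq4: "act a q2 \<noteq> q2"
    using act_commute[OF ab AB(3) p(1)] act_eq_iff[OF bG q(1) p(1)] p(2) unfolding q1_def q2_def by simp
  have rp: "r \<noteq> p" using p(2) r(2) by auto
  have ne: "p \<noteq> q1" "p \<noteq> q2" "r \<noteq> q1" "r \<noteq> q2" "r \<noteq> p" "q1 \<noteq> p" "q2 \<noteq> p" "q1 \<noteq> r" "q2 \<noteq> r"
    using p(2,3) r(2,3) mq1 mq2 rp unfolding q1_def[symmetric] q2_def[symmetric] by auto
  obtain g where g: "g \<in> G" "act g p = r" "act g q1 = q1" "act g q2 = q2"
  proof (cases "q1 = q2")
    case True
    \<comment> \<open>With \<open>q1 = q2\<close> only two conditions remain; \<open>r\<close> is
      sent to \<open>p\<close> to complete a triple.\<close>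
    show ?thesis
      by (rule transitive3[of p q1 r r q1 p]) (use p(1) q r(1) ne True that in auto)
  next
    case False
    show ?thesis
      by (rule transitive3[of p q1 q2 r q1 q2]) (use p(1) q r(1) ne False that in auto)
  qed
  have key: False
    if c: "c \<in> rigid C" and e: "e \<in> rigid E" and CE: "g ` C \<inter> E = {}"
      and s: "act c p = s" "act g s = s" "act e s \<noteq> s" and er: "act e r = r" for c C e E s
  proof -
    have "act (conj_by g c) r = s"
      using act_conj_by[OF g(1) rigid_G[OF c] p(1)] g(2) s by simp
    then show False
      using act_commute[OF rigid_conj_by[OF c g(1)] e CE r(1)] er s(3) by simp
  qed
  note d = image_disjoint[OF g(1) AB(3)]
  obtain C E where CE: "C \<in> {g ` A, g ` B}" "E \<in> {A, B}" "C \<inter> E = {}"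
    by (rule halftrees_disjoint_pair[OF G_halftree[OF g(1) AB(1)] G_halftree[OF g(1) AB(2)] d AB])
  show False
    using CE key[OF ab(1) ab(1) _ q1_def[symmetric] g(3) mq1 r(2)]
      key[OF ab(1) ab(2) _ q1_def[symmetric] g(3) mq3 r(3)]
      key[OF ab(2) ab(1) _ q2_def[symmetric] g(4) mq4 r(2)]
      key[OF ab(2) ab(2) _ q2_def[symmetric] g(4) mq2 r(3)] by auto
qed

section \<open>Elements with a fixed point and their overlaps\<close>

definition fixers :: "'v set \<Rightarrow> ('v \<Rightarrow> 'v) set" where
  "fixers A = {u \<in> rigid A. u \<noteq> id \<and> (\<exists>x\<in>\<Omega>. act u x = x)}"

definition overlap :: "('v \<Rightarrow> 'v) \<Rightarrow> ('v \<Rightarrow> 'v) \<Rightarrow> bool" where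
  "overlap u b \<longleftrightarrow> (\<exists>x\<in>\<Omega>. act u x \<noteq> x \<and> act b x \<noteq> x)"

lemma fixers_rigid: "u \<in> fixers A \<Longrightarrow> u \<in> rigid A"
  and fixers_neq: "u \<in> fixers A \<Longrightarrow> u \<noteq> id"
  unfolding fixers_def by auto

lemma fixers_mono: "u \<in> fixers A \<Longrightarrow> A \<subseteq> B \<Longrightarrow> u \<in> fixers B"
  unfolding fixers_def using rigid_mono by auto

lemma fixers_conj_by: assumes "u \<in> fixers A" "g \<in> G" shows "conj_by g u \<in> fixers (g ` A)"
proof -
  obtain x where x: "x \<in> \<Omega>" "act u x = x" using assms(1) unfolding fixers_def by blast
  have "act (conj_by g u) (act g x) = act g x"
    using act_conj_by[OF assms(2) rigid_G[OF fixers_rigid[OF assms(1)]] x(1)] x(2) by simp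
  then show ?thesis
    using rigid_conj_by[OF fixers_rigid[OF assms(1)] assms(2)]
      conj_by_neq_id[OF assms(2) fixers_neq[OF assms(1)]] act_closed[OF assms(2) x(1)]
    unfolding fixers_def by blast
qed

lemma moved_conj_by:
  assumes "g \<in> G" "u \<in> G" "x \<in> \<Omega>" "act u x \<noteq> x" shows "act (conj_by g u) (act g x) \<noteq> act g x"
  using act_conj_by[OF assms(1-3)] act_eq_iff[OF assms(1) act_closed[OF assms(2,3)] assms(3)] assms(4)
  by simp

lemma overlap_conj_by:
  assumes "overlap u b" "u \<in> G" "b \<in> G" "g \<in> G" shows "overlap (conj_by g u) (conj_by g b)"
proof -
  obtain x where x: "x \<in> \<Omega>" "act u x \<noteq> x" "act b x \<noteq> x" using assms(1) unfolding overlap_def by blast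
  then show ?thesis
    using moved_conj_by[OF assms(4,2) x(1,2)] moved_conj_by[OF assms(4,3) x(1,3)]
      act_closed[OF assms(4) x(1)] unfolding overlap_def by blast
qed

lemma overlap_sym: "overlap u b \<Longrightarrow> overlap b u"
  unfolding overlap_def by blast

text \<open>For disjoint supports, an overlap excludes a common fixed point. If \<open>u\<close> and
  \<open>c\<close> did not overlap, a point \<open>y\<close> moved by \<open>c\<close> would be
  fixed by \<open>u\<close>, hence moved by \<open>b\<close>, so \<open>b\<close> and
  \<open>c\<close> overlap as well. A fixed point of \<open>b\<close> is then moved by
  \<open>u\<close> and by \<open>c\<close>, an overlap after all.\<close>

lemma overlap_spread:
  assumes ht: "A \<in> halftrees" "B \<in> halftrees" "C \<in> halftrees"
    and dj: "A \<inter> B = {}" "A \<inter> C = {}" "B \<inter> C = {}"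
    and u: "u \<in> fixers A" and b: "b \<in> fixers B" and c: "c \<in> fixers C" and ov: "overlap u b"
  shows "overlap u c"
proof (rule ccontr)
  assume no: "\<not> overlap u c"
  note R = fixers_rigid[OF u] fixers_rigid[OF b] fixers_rigid[OF c]
  obtain y where y: "y \<in> \<Omega>" "act c y \<noteq> y" by (rule moves[OF rigid_G[OF R(3)] fixers_neq[OF c]])
  have uy: "act u y = y" using no y unfolding overlap_def by blast
  obtain p where p: "p \<in> \<Omega>" "act u p \<noteq> p" "act b p \<noteq> p" using ov unfolding overlap_def by blast
  have by': "act b y \<noteq> y"
    using common_fixed_no_common_moved[OF ht(1,2) dj(1) R(1,2) y(1) uy _ p] by blast
  obtain r where r: "r \<in> \<Omega>" "act b r = r" using b unfolding fixers_def by blast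
  have "act u r \<noteq> r"
    using common_fixed_no_common_moved[OF ht(1,2) dj(1) R(1,2) r(1) _ r(2) p] by blast
  moreover have "act c r \<noteq> r"
    using common_fixed_no_common_moved[OF ht(2,3) dj(3) R(2,3) r _ y(1) by' y(2)] by blast
  ultimately show False using no r(1) unfolding overlap_def by blast
qed

text \<open>Common to both cases of the dichotomy: \<open>P u x\<close> will mean that
  \<open>u\<close> moves \<open>x\<close>, or that \<open>u\<close> fixes \<open>x\<close>.\<close>

lemma conjugate_of_property:
  assumes equiv: "\<And>g u x. g \<in> G \<Longrightarrow> u \<in> G \<Longrightarrow> x \<in> \<Omega> \<Longrightarrow> P u x \<Longrightarrow> P (conj_by g u) (act g x)"
    and ex: "A0 \<in> halftrees" "u0 \<in> fixers A0" "x0 \<in> \<Omega>" "P u0 x0"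
    and excl: "\<And>A B C u b x. A \<in> halftrees \<Longrightarrow> B \<in> halftrees \<Longrightarrow> C \<in> halftrees \<Longrightarrow>
      A \<inter> B = {} \<Longrightarrow> A \<inter> C = {} \<Longrightarrow> B \<inter> C = {} \<Longrightarrow> u \<in> fixers A \<Longrightarrow> b \<in> fixers B \<Longrightarrow>
      x \<in> \<Omega> \<Longrightarrow> P u x \<Longrightarrow> P b x \<Longrightarrow> False"
  shows "\<exists>\<xi>\<in>ends adj. conjugate_actions G \<Omega> act (end_orbit G \<xi>) end_act"
proof -
  \<comment> \<open>The spare half-tree \<open>C\<close> leaves room for the three disjoint half-trees in \<open>excl\<close>.\<close>
  define Q where "Q A' C u x \<longleftrightarrow> A' \<in> halftrees \<and> C \<in> halftrees \<and> A' \<inter> C = {} \<and> u \<in> fixers A' \<and> P u x"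
    for A' C u x
  define S where "S x = {A \<in> halftrees. \<exists>A' C u. A' \<subseteq> A \<and> C \<subseteq> A \<and> Q A' C u x}" for x
  show ?thesis
  proof (rule conjugate_of_family[of S x0])
    show "S x \<subseteq> halftrees" for x unfolding S_def by blast
    show "B \<in> S x" if "A \<in> S x" "B \<in> halftrees" "A \<subseteq> B" for x A B
      using that unfolding S_def by blast
    show "g ` A \<in> S (act g x)" if g: "g \<in> G" and x: "x \<in> \<Omega>" and A: "A \<in> S x" for g x A
    proof -
      obtain A' C u where *: "A' \<subseteq> A" "C \<subseteq> A" "Q A' C u x" using A unfolding S_def by blast
      have "u \<in> G" using *(3) rigid_G fixers_rigid unfolding Q_def by blast
      then have "P (conj_by g u) (act g x)" using equiv[OF g _ x] *(3) unfolding Q_def by blast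
      moreover have "g ` A' \<inter> g ` C = {}"
        using *(3) image_disjoint[OF g] unfolding Q_def by simp
      ultimately have "Q (g ` A') (g ` C) (conj_by g u) (act g x)"
        using *(3) G_halftree[OF g] fixers_conj_by[OF _ g] unfolding Q_def by simp
      moreover have "g ` A \<in> halftrees" using A G_halftree[OF g] unfolding S_def by blast
      moreover note image_mono[OF *(1), of g] image_mono[OF *(2), of g]
      ultimately show ?thesis unfolding S_def by blast
    qed
    show "x0 \<in> \<Omega>" by fact
    show "S x0 \<noteq> {}"
    proof -
      \<comment> \<open>The complement of \<open>A0\<close> is split so that \<open>- D\<close> has
        room for \<open>C\<close> beside \<open>A0\<close> and is still a half-tree.\<close>
      obtain C D where CD: "C \<in> halftrees" "D \<in> halftrees" "C \<subseteq> - A0" "D \<subseteq> - A0" "C \<inter> D = {}"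
        by (rule halftree_split[OF halftree_compl[OF ex(1)]])
      have "Q A0 C u0 x0" using ex CD unfolding Q_def by blast
      moreover have "A0 \<subseteq> - D" "C \<subseteq> - D" using CD by auto
      ultimately show ?thesis using halftree_compl[OF CD(2)] unfolding S_def by blast
    qed
    show "A \<inter> B \<noteq> {}" if x: "x \<in> \<Omega>" and A: "A \<in> S x" and B: "B \<in> S x" for x A B
    proof
      assume e: "A \<inter> B = {}"
      obtain A' C u where 1: "A' \<subseteq> A" "C \<subseteq> A" "Q A' C u x" using A unfolding S_def by blast
      obtain B' C' b where 2: "B' \<subseteq> B" "Q B' C' b x" using B unfolding S_def by blast
      have "A' \<inter> B' = {}" "B' \<inter> C = {}" using 1(1,2) 2(1) e by auto
      then show False using excl[of A' B' C u b x] 1(3) 2(2) x unfolding Q_def by blast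
    qed
  qed
qed

lemma conjugate_of_fixers:
  assumes ex: "A0 \<in> halftrees" "u0 \<in> fixers A0"
  shows "\<exists>\<xi>\<in>ends adj. conjugate_actions G \<Omega> act (end_orbit G \<xi>) end_act"
proof (cases "\<exists>A B C u b. A \<in> halftrees \<and> B \<in> halftrees \<and> C \<in> halftrees \<and>
    A \<inter> B = {} \<and> A \<inter> C = {} \<and> B \<inter> C = {} \<and> u \<in> fixers A \<and> b \<in> fixers B \<and> overlap u b")
  case False
  obtain x0 where x0: "x0 \<in> \<Omega>" "act u0 x0 \<noteq> x0"
    by (rule moves[OF rigid_G[OF fixers_rigid[OF ex(2)]] fixers_neq[OF ex(2)]])
  show ?thesis
  proof (rule conjugate_of_property[where P = "\<lambda>u x. act u x \<noteq> x", OF _ ex x0])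
    show "act (conj_by g u) (act g x) \<noteq> act g x" if "g \<in> G" "u \<in> G" "x \<in> \<Omega>" "act u x \<noteq> x" for g u x
      using moved_conj_by[OF that] .
    show False if "A \<in> halftrees" "B \<in> halftrees" "C \<in> halftrees" "A \<inter> B = {}" "A \<inter> C = {}" "B \<inter> C = {}"
      "u \<in> fixers A" "b \<in> fixers B" "x \<in> \<Omega>" "act u x \<noteq> x" "act b x \<noteq> x" for A B C u b x
    proof -
      have "overlap u b" using that(9-11) unfolding overlap_def by blast
      with False that(1-8) show ?thesis by blast
    qed
  qed
next
  case True
  then obtain A B C u b where 1: "A \<in> halftrees" "B \<in> halftrees" "C \<in> halftrees"
    "A \<inter> B = {}" "A \<inter> C = {}" "B \<inter> C = {}" "u \<in> fixers A" "b \<in> fixers B" "overlap u b" by blast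
  have ex_fixers: "\<exists>c. c \<in> fixers C" if C: "C \<in> halftrees" for C
  proof -
    obtain g where g: "g \<in> G" "g ` A0 \<subseteq> C" by (rule halftree_into[OF C ex(1)])
    show ?thesis using fixers_mono[OF fixers_conj_by[OF ex(2) g(1)] g(2)] by blast
  qed
  have all: "overlap u' b'"
    if 2: "A' \<in> halftrees" "B' \<in> halftrees" "C' \<in> halftrees" "A' \<inter> B' = {}" "A' \<inter> C' = {}"
      "B' \<inter> C' = {}" "u' \<in> fixers A'" "b' \<in> fixers B'" for A' B' C' u' b'
  proof -
    \<comment> \<open>The overlapping pair is supported in the complement of \<open>C\<close>, so
      \<open>k\<close> brings it into \<open>C'\<close>, away from \<open>A'\<close> and
      \<open>B'\<close>. Members are then exchanged one at a time: first \<open>?b\<close> for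
      \<open>u'\<close>, then \<open>?u\<close> for \<open>b'\<close>.\<close>
    obtain k where k: "k \<in> G" "k ` (- C) \<subseteq> C'" by (rule halftree_into[OF 2(3) halftree_compl[OF 1(3)]])
    note uG = rigid_G[OF fixers_rigid[OF 1(7)]] and bG = rigid_G[OF fixers_rigid[OF 1(8)]]
    let ?u = "conj_by k u" and ?b = "conj_by k b"
    have fx: "?u \<in> fixers (k ` A)" "?b \<in> fixers (k ` B)" using fixers_conj_by 1(7,8) k(1) by auto
    have kh: "k ` A \<in> halftrees" "k ` B \<in> halftrees" using G_halftree[OF k(1)] 1(1,2) by auto
    have sub: "k ` A \<subseteq> C'" "k ` B \<subseteq> C'" using 1(5,6) k(2) by auto
    note dj = image_disjoint[OF k(1) 1(4)]
    have dA: "k ` A \<inter> A' = {}" "k ` B \<inter> A' = {}" using sub 2(5) by auto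
    have "overlap ?u ?b" by (rule overlap_conj_by[OF 1(9) uG bG k(1)])
    then have "overlap ?u u'" by (rule overlap_spread[OF kh 2(1) dj dA fx 2(7)])
    then have "overlap u' ?u" by (rule overlap_sym)
    moreover have "?u \<in> fixers C'" using fixers_mono[OF fx(1) sub(1)] .
    moreover have "C' \<inter> B' = {}" using 2(6) by blast
    ultimately show ?thesis using overlap_spread[OF 2(1,3,2) 2(5,4) _ 2(7) _ 2(8)] by blast
  qed
  obtain x0 where x0: "x0 \<in> \<Omega>" "act u0 x0 = x0" using ex(2) unfolding fixers_def by blast
  show ?thesis
  proof (rule conjugate_of_property[where P = "\<lambda>u x. act u x = x", OF _ ex x0])
    show "act (conj_by g u) (act g x) = act g x" if "g \<in> G" "u \<in> G" "x \<in> \<Omega>" "act u x = x" for g u x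
      using act_conj_by[OF that(1-3)] that(4) by simp
    show False if 2: "A \<in> halftrees" "B \<in> halftrees" "C \<in> halftrees" "A \<inter> B = {}" "A \<inter> C = {}" "B \<inter> C = {}"
      "u \<in> fixers A" "b \<in> fixers B" "x \<in> \<Omega>" "act u x = x" "act b x = x" for A B C u b x
    proof -
      obtain p where p: "p \<in> \<Omega>" "act u p \<noteq> p" "act b p \<noteq> p"
        using all[OF 2(1-8)] unfolding overlap_def by blast
      show False
        by (rule common_fixed_no_common_moved[OF 2(1,2,4) fixers_rigid[OF 2(7)] fixers_rigid[OF 2(8)] 2(9-11) p])
    qed
  qed
qed

section \<open>Existence of rigid elements with a fixed point\<close>

text \<open>Without fixed points the rigid group acts freely on \<Omega>, so the image of a single
  point determines its element.\<close>

lemma eq_of_free: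
  assumes free: "fixers A = {}"
    and a: "a \<in> rigid A" and b: "b \<in> rigid A" and x: "x \<in> \<Omega>" "act a x = act b x"
  shows "a = b"
proof (rule ccontr)
  assume n: "a \<noteq> b"
  note aG = rigid_G[OF a] and bG = rigid_G[OF b]
  let ?c = "inv b \<circ> a"
  have c: "?c \<in> rigid A" by (rule rigid_comp[OF rigid_inv[OF b] a])
  have "act ?c x = x"
    using act_comp[OF G_inv[OF bG] aG x(1)] x(2) act_inv(1)[OF bG x(1)] by simp
  moreover have "?c \<noteq> id"
  proof
    assume i: "?c = id"
    have "a v = b v" for v
      using fun_cong[OF i, of v] inv_apply(2)[OF bG, of "a v"] by simp
    then show False using n by blast
  qed
  ultimately have "?c \<in> fixers A" using c x(1) unfolding fixers_def by blast
  then show False using free by blast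
qed

text \<open>The elements \<open>u\<close> and \<open>v\<close> do not commute, and each of them moves a half-tree fixed by the other one.
  By freeness one of them coincides with a conjugate of \<open>t1\<close> or \<open>t2\<close>;
  this forces the other coincidence, although \<open>t1\<close> and \<open>t2\<close> commute.\<close>
lemma fixers_exist:
  assumes nonfree: "\<not> topologically_free adj G"
  shows "\<exists>A\<in>halftrees. fixers A \<noteq> {}"
proof (rule ccontr)
  assume "\<not> ?thesis"
  then have free: "\<And>A. A \<in> halftrees \<Longrightarrow> fixers A = {}" by blast
  note eq = eq_of_free[OF free]
  obtain g0 l k where "g0 \<in> G" "translates adj g0 l k"
    using general unfolding general_type_def hyperbolic_def by blast
  then have "H (l 0) (l (0 + 1)) \<in> halftrees" by (intro halftreeI line_adj) (simp add: translates_def)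
  \<comment> \<open>\<open>B1\<close> and \<open>B2\<close> carry the elements; \<open>B3\<close>
    and \<open>B4\<close> stay fixed and form the pair against which the images of \<open>B1\<close>
    and \<open>B2\<close> are tested.\<close>
  then obtain B1 B2 B3 B4 where B: "B1 \<in> halftrees" "B2 \<in> halftrees" "B3 \<in> halftrees" "B4 \<in> halftrees"
    and dj: "B1 \<inter> B2 = {}" "B1 \<inter> B3 = {}" "B1 \<inter> B4 = {}" "B2 \<inter> B3 = {}" "B2 \<inter> B4 = {}" "B3 \<inter> B4 = {}"
    by (rule halftree_split4)
  obtain t1 where t1: "t1 \<in> rigid B1" "t1 \<noteq> id" by (rule rigid_exists[OF nonfree B(1)])
  obtain t2 where t2: "t2 \<in> rigid B2" "t2 \<noteq> id" by (rule rigid_exists[OF nonfree B(2)])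
  obtain E where E: "E \<in> halftrees" "E \<subseteq> B1" "t1 ` E \<inter> E = {}" by (rule displaced_by_rigid[OF B(1) t1])
  obtain F where F: "F \<in> halftrees" "F \<subseteq> B2" "t2 ` F \<inter> F = {}" by (rule displaced_by_rigid[OF B(2) t2])
  obtain v0 where v0: "v0 \<in> rigid E" "v0 \<noteq> id" by (rule rigid_exists[OF nonfree E(1)])
  define u where "u = t1"
  \<comment> \<open>The factor \<open>v0\<close> spoils commutation with \<open>u\<close>, which
    pushes \<open>E\<close> off itself; the factor \<open>t2\<close> makes \<open>v\<close> move the
    half-tree \<open>F\<close>, fixed by \<open>u\<close>.\<close>
  define v where "v = v0 \<circ> t2"
  have u: "u \<in> rigid B1" "u ` E \<inter> E = {}" using t1 E(3) unfolding u_def by auto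
  have uE: "u ` E \<subseteq> B1" using rigid_image[OF u(1)] E(2) by blast
  obtain x1 where x1: "v0 x1 \<noteq> x1" using v0(2) by fastforce
  then have x1E: "x1 \<in> E" using rigid_fix[OF v0(1)] by blast
  have v_uE: "v y = y" if "y \<in> u ` E" for y
  proof -
    have "y \<notin> B2" "y \<notin> E" using that uE u(2) dj(1) by auto
    then show ?thesis using rigid_fix[OF t2(1)] rigid_fix[OF v0(1)] by (simp add: v_def)
  qed
  have v_F: "v y \<noteq> y" if "y \<in> F" for y
  proof -
    have "t2 y \<in> B2" using rigid_image[OF t2(1)] that F(2) by blast
    then have "t2 y \<notin> E" using E(2) dj(1) by blast
    then have "v y = t2 y" using rigid_fix[OF v0(1)] by (simp add: v_def)
    moreover have "t2 y \<noteq> y" using that F(3) by fastforce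
    ultimately show ?thesis by simp
  qed
  have v_x1: "v x1 \<noteq> x1"
  proof -
    have "x1 \<notin> B2" using x1E E(2) dj(1) by blast
    then show ?thesis using x1 rigid_fix[OF t2(1)] by (simp add: v_def)
  qed
  have vu: "v (u x1) = u x1" using v_uE x1E by blast
  have noncomm: "u \<circ> v \<noteq> v \<circ> u"
  proof
    assume "u \<circ> v = v \<circ> u"
    from fun_cong[OF this, of x1] have "u (v x1) = u x1" using vu by simp
    then show False using v_x1 rigid_eq_iff[OF u(1)] by simp
  qed
  have sub: "B1 \<subseteq> - B3" "B1 \<subseteq> - B4" "B2 \<subseteq> - B3" "B2 \<subseteq> - B4" "E \<subseteq> - B3" "E \<subseteq> - B4"
    using dj E(2) by blast+
  note uR = rigid_mono[OF u(1) sub(1)] rigid_mono[OF u(1) sub(2)]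
  have vR: "v \<in> rigid (- B3)" "v \<in> rigid (- B4)"
    unfolding v_def
    by (rule rigid_comp[OF rigid_mono[OF v0(1) sub(5)] rigid_mono[OF t2(1) sub(3)]])
      (rule rigid_comp[OF rigid_mono[OF v0(1) sub(6)] rigid_mono[OF t2(1) sub(4)]])
  note C = halftree_compl[OF B(3)] halftree_compl[OF B(4)]
  note tR = rigid_mono[OF t1(1) sub(1)] rigid_mono[OF t2(1) sub(3)]
  have uG: "u \<in> G" and vG: "v \<in> G" and t1G: "t1 \<in> G" and t2G: "t2 \<in> G"
    by (rule rigid_G[OF uR(1)] rigid_G[OF vR(1)] rigid_G[OF t1(1)] rigid_G[OF t2(1)])+
  have u_id: "u \<noteq> id" using t1(2) u_def by simp
  have v_id: "v \<noteq> id" using v_x1 by (metis id_apply)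
  have uv: "u \<noteq> v" using noncomm by metis
  have t12: "t1 \<noteq> t2"
  proof
    assume "t1 = t2"
    then have "t1 \<in> rigid B2" using t2(1) by simp
    from rigid_disjoint_eq[OF t1(1) this dj(1)] t1(2) show False by simp
  qed
  have idR: "id \<in> rigid A" for A using G_id unfolding rigid_def by simp
  obtain p where p: "p \<in> \<Omega>" by (rule third_point)
  have act_ne: "act a p \<noteq> act b p" if "a \<in> rigid (- B3)" "b \<in> rigid (- B3)" "a \<noteq> b" for a b
    using that(3) by (rule contrapos_nn) (rule eq[OF C(1) that(1,2) p])
  have idp: "act id p = p" using act_id[OF p] .
  have ne: "act t1 p \<noteq> p" "act t2 p \<noteq> p" "act t1 p \<noteq> act t2 p" "act u p \<noteq> p" "act v p \<noteq> p" "act u p \<noteq> act v p"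
    using act_ne[OF tR(1) idR t1(2)] act_ne[OF tR(2) idR t2(2)] act_ne[OF tR t12]
      act_ne[OF uR(1) idR u_id] act_ne[OF vR(1) idR v_id] act_ne[OF uR(1) vR(1) uv] idp by auto
  \<comment> \<open>The conjugates of \<open>t1\<close> and \<open>t2\<close> by \<open>g\<close>
    will agree with \<open>u\<close> and \<open>v\<close> at \<open>p\<close>. Agreement at
    \<open>p\<close> becomes equality as soon as both elements are supported in one
    half-tree.\<close>
  obtain g where g: "g \<in> G" "act g p = p" "act g (act t1 p) = act u p" "act g (act t2 p) = act v p"
    by (rule transitive3[of p "act t1 p" "act t2 p" p "act u p" "act v p"])
      (use p ne act_closed[OF _ p] uG vG t1G t2G in auto)
  define s1 where "s1 = conj_by g t1"
  define s2 where "s2 = conj_by g t2"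
  have s1: "s1 \<in> rigid (g ` B1)" and s2: "s2 \<in> rigid (g ` B2)"
    unfolding s1_def s2_def by (rule rigid_conj_by[OF t1(1) g(1)] rigid_conj_by[OF t2(1) g(1)])+
  have s1p: "act s1 p = act u p" and s2p: "act s2 p = act v p"
    using act_conj_by[OF g(1) t1G p] act_conj_by[OF g(1) t2G p] g(2-4) unfolding s1_def s2_def by auto
  note gB = G_halftree[OF g(1) B(1)] G_halftree[OF g(1) B(2)]
  note gdj = image_disjoint[OF g(1) dj(1)]
  have s_comm: "s1 \<circ> s2 = s2 \<circ> s1" by (rule rigid_commute[OF s1 s2 gdj])
  have fixE: "a \<in> rigid (- K)" if "a \<in> G" "\<And>y. y \<in> K \<Longrightarrow> a y = y" for a K
    using that unfolding rigid_def by blast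
  have uEh: "u ` E \<in> halftrees" using G_halftree[OF uG E(1)] .
  \<comment> \<open>\<open>u\<close> moves every vertex of \<open>u\<close>
    E\<open>, so this half-tree lies in the support\<close>g \<open>B1\<close> of \<open>s1\<close>
    and is fixed by \<open>s2\<close>; it is fixed by \<open>v\<close> too, unlike \<open>E\<close>
    itself. Hence \<open>s2\<close> and \<open>v\<close> are comparable in the rigid group of its
    complement. The converse below uses \<open>F\<close> in the same way.\<close>
  have 1: "s2 = v" if e: "s1 = u"
  proof -
    have "u ` E \<subseteq> g ` B1"
    proof
      fix y assume y: "y \<in> u ` E"
      then have "u y \<in> u ` (u ` E)" by blast
      moreover have "u ` (u ` E) \<inter> u ` E = {}" by (rule image_disjoint[OF uG u(2)])
      ultimately have "u y \<noteq> y" using y by force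
      then show "y \<in> g ` B1" using rigid_fix[OF s1, of y] e by blast
    qed
    then have "s2 y = y" if "y \<in> u ` E" for y using rigid_fix[OF s2, of y] that gdj by blast
    then have "s2 \<in> rigid (- (u ` E))" by (rule fixE[OF rigid_G[OF s2]])
    moreover have "v \<in> rigid (- (u ` E))" by (rule fixE[OF vG v_uE])
    ultimately show ?thesis by (rule eq[OF halftree_compl[OF uEh] _ _ p s2p])
  qed
  have 2: "s1 = u" if e: "s2 = v"
  proof -
    have "F \<subseteq> g ` B2"
    proof
      fix y assume "y \<in> F"
      then have "s2 y \<noteq> y" using v_F e by simp
      then show "y \<in> g ` B2" using rigid_fix[OF s2, of y] by blast
    qed
    then have "s1 y = y" if "y \<in> F" for y using rigid_fix[OF s1, of y] that gdj by blast
    then have "s1 \<in> rigid (- F)" by (rule fixE[OF rigid_G[OF s1]])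
    moreover have "u \<in> rigid (- F)" by (rule rigid_mono[OF u(1)]) (use F(2) dj(1) in blast)
    ultimately show ?thesis by (rule eq[OF halftree_compl[OF F(1)] _ _ p s1p])
  qed
  \<comment> \<open>If \<open>K\<close> is \<open>g\<close>
    B1\<open>, then\<close>s1\<open>and\<close>u\<open>are both supported off\<close>L\<open>and so coincide; if\<close>K\<open>is\<close>g
    \<open>B2\<close>, the same holds for \<open>s2\<close> and \<open>v\<close>.\<close>
  obtain K L where KL: "K \<in> {g ` B1, g ` B2}" "L \<in> {B3, B4}" "K \<inter> L = {}"
    by (rule halftrees_disjoint_pair[OF gB gdj B(3,4) dj(6)])
  have KL': "K \<subseteq> - L" and Lh: "- L \<in> halftrees" and uL: "u \<in> rigid (- L)" and vL: "v \<in> rigid (- L)"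
    using KL(2,3) C uR vR by auto
  have "s1 = u \<or> s2 = v"
  proof (cases "K = g ` B1")
    case True
    then have "s1 \<in> rigid (- L)" using rigid_mono[OF s1] KL' by simp
    from eq[OF Lh this uL p s1p] show ?thesis ..
  next
    case False
    then have "s2 \<in> rigid (- L)" using rigid_mono[OF s2] KL' KL(1) by simp
    from eq[OF Lh this vL p s2p] show ?thesis ..
  qed
  then have "s1 = u" "s2 = v" using 1 2 by auto
  then show False using s_comm noncomm by simp
qed

end

theorem theorem1p4:
  fixes adj :: "'v \<Rightarrow> 'v \<Rightarrow> bool"
    and G :: "('v \<Rightarrow> 'v) set"
    and \<Omega> :: "'w set"
    and act :: "('v \<Rightarrow> 'v) \<Rightarrow> 'w \<Rightarrow> 'w"
  assumes "is_tree adj"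
    and "aut_subgroup adj G"
    and "minimal_action adj G"
    and "general_type adj G"
    and "\<not> topologically_free adj G"
    and "is_action (\<circ>) id G \<Omega> act"
    and "faithful_action id G \<Omega> act"
    and "three_transitive G \<Omega> act"
  shows "\<exists>\<xi>\<in>ends adj. conjugate_actions G \<Omega> act (end_orbit G \<xi>) end_act"
proof -
  interpret tree_action adj G \<Omega> act
    using assms by unfold_locales
  show ?thesis using fixers_exist[OF assms(5)] conjugate_of_fixers by blast
qed

end
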